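(* Let $A\in\mathbb{R}^{m_1\times n_1}$, $a\in\mathbb{R}^{1\times n_1}$ with $a\neq 0$, $b\in\mathbb{R}^{1\times n_2}$ with $b\neq 0$, $B\in\mathbb{R}^{m_2\times n_2}$, $c_A\in\mathbb{R}^{m_1}$, $c_B\in\mathbb{R}^{m_2}$ and $c\in\mathbb{R}$. Consider the ($2$-sum) polyhedron \[ R=\{(x,y)\in\mathbb{R}^{n_1}\times\mathbb{R}^{n_2} : Ax=c_A,\ ax+by=c,\ By=c_B,\ x\ge 0,\ y\ge 0\}. \] Let $\bar A=\begin{bmatrix}A\\ a\end{bmatrix}$ and $\bar B=\begin{bmatrix}b\\ B\end{bmatrix}$. Then the combinatorial diameter of $R$ satisfies \[ d(R)\le d(A)\,(d(\bar A)+1)+d(B)\,(d(\bar B)+1)+\min\{d(\bar A)+d(B)+1,\ d(A)+d(\bar B)+1\}. \]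
   Context: The distance $d_P(v,w)$ between two vertices of a polyhedron $P$ is the minimum number of edges in an edge walk from $v$ to $w$ in the graph of $P$; the (combinatorial) diameter $d(P)$ is the maximum of $d_P(v,w)$ over all pairs of vertices. For a matrix $M\in\mathbb{R}^{m\times n}$, $d(M):=\max\{d(\{x: Mx=r,\ x\ge 0\}) : r\in\mathbb{R}^m\}$, i.e., the largest diameter of any standard-form polyhedron with equality constraint matrix $M$. *)

theory Defs
  imports "HOL-Analysis.Analysis" "HOL-Library.Extended_Nat"
begin

definition vertex_adj :: "'a::real_vector set \<Rightarrow> 'a \<Rightarrow> 'a \<Rightarrow> bool" where
  "vertex_adj P v w \<longleftrightarrow> v \<noteq> w \<and> v extreme_point_of P \<and> w extreme_point_of P
      \<and> closed_segment v w face_of P"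

definition edge_walk :: "'a::real_vector set \<Rightarrow> 'a list \<Rightarrow> bool" where
  "edge_walk P xs \<longleftrightarrow> xs \<noteq> [] \<and> (\<forall>i < length xs - 1. vertex_adj P (xs ! i) (xs ! Suc i))"

text \<open>Distance: minimum number of edges of a walk from v to w (infinity if none).\<close>
definition poly_dist :: "'a::real_vector set \<Rightarrow> 'a \<Rightarrow> 'a \<Rightarrow> enat" where
  "poly_dist P v w =
     (INF xs \<in> {xs. edge_walk P xs \<and> hd xs = v \<and> last xs = w}. enat (length xs - 1))"

text \<open>Combinatorial diameter: maximum distance over pairs of vertices (0 if no vertices).\<close>
definition poly_diam :: "'a::real_vector set \<Rightarrow> enat" where
  "poly_diam P =
     (SUP vw \<in> {(v, w). v extreme_point_of P \<and> w extreme_point_of P}. poly_dist P (fst vw) (snd vw))"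

definition std_poly :: "real^'n^'m \<Rightarrow> real^'m \<Rightarrow> (real^'n) set" where
  "std_poly M r = {x. M *v x = r \<and> (\<forall>i. 0 \<le> x $ i)}"

definition mat_diam :: "real^'n^'m \<Rightarrow> enat" where
  "mat_diam M = (SUP r. poly_diam (std_poly M r))"

definition stack_below :: "real^'n^'m \<Rightarrow> real^'n \<Rightarrow> real^'n^('m option)" where
  "stack_below A a = (\<chi> i. case i of None \<Rightarrow> a | Some j \<Rightarrow> A $ j)"

definition stack_above :: "real^'n \<Rightarrow> real^'n^'m \<Rightarrow> real^'n^('m option)" where
  "stack_above b B = (\<chi> i. case i of None \<Rightarrow> b | Some j \<Rightarrow> B $ j)"

end

theory Submission
  imports Defs
begin

text \<open>
  Put \<open>P = std_poly A cA\<close>, \<open>Q = std_poly B cB\<close>, \<open>f x = a \<bullet> x\<close> and \<open>g y = c - b \<bullet> y\<close>, so that \<open>R\<close> is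
  the set of pairs in \<open>P \<times> Q\<close> on which the levels \<open>f\<close> and \<open>g\<close> agree.  At a vertex \<open>(x, y)\<close> of \<open>R\<close>, one
  component is a vertex and the other one is a vertex or lies on an edge along which its level
  varies.  Two kinds of moves are available: a tandem move along an edge of \<open>P\<close> and an edge of \<open>Q\<close>
  costs one edge of \<open>R\<close>, and while \<open>y\<close> is a vertex of \<open>Q\<close>, the component \<open>x\<close> can jump to any vertex of
  the slice of \<open>P\<close> at its level at the cost of the diameter of the stacked matrix (and symmetrically).

  Join the components of two vertices of \<open>R\<close> by shortest edge walks in \<open>P\<close> and in \<open>Q\<close>.  As in the
  mountain climbing problem both components have to move with equal levels.  If all later levels
  exceed the starting level, one proceeds to the lowest of these levels; jumps skip the detours, and
  a jump in \<open>P\<close> is only needed where at least two edges of the walk in \<open>P\<close> are passed.  Two such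
  climbs, started at the higher one of the lowest levels of the two walks, are glued by one more jump.
  This gives the bound \<open>d(A) (d(A') + 1) + d(B) (d(B') + 1) + 1\<close>, where \<open>A'\<close> and \<open>B'\<close> are the stacked
  matrices; if \<open>d(A) = 0\<close>, the gluing jump is paid for by \<open>d(A') \<le> 1\<close>.
\<close>

section \<open>Climbing with equal levels\<close>

text \<open>An edge walk whose two ends may lie inside an edge, as components of vertices of
  \<open>R\<close> do. Consecutive points share a set in \<open>F\<close>, later a collinear face,
  so rays and lines are covered too.\<close>

definition chain :: "('a \<Rightarrow> bool) \<Rightarrow> ('a set \<Rightarrow> bool) \<Rightarrow> (nat \<Rightarrow> 'a) \<Rightarrow> nat \<Rightarrow> bool" where
  "chain V F u n \<longleftrightarrow> (\<forall>i<n. \<exists>E. F E \<and> u i \<in> E \<and> u (Suc i) \<in> E) \<and> (\<forall>i. 0 < i \<and> i < n \<longrightarrow> V (u i))"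

definition nonconst :: "('a \<Rightarrow> real) \<Rightarrow> 'a set \<Rightarrow> bool" where
  "nonconst h S \<longleftrightarrow> (\<exists>p\<in>S. \<exists>q\<in>S. h p \<noteq> h q)"

lemma nonconstI: "p \<in> S \<Longrightarrow> q \<in> S \<Longrightarrow> h p \<noteq> h q \<Longrightarrow> nonconst h S"
  unfolding nonconst_def by blast

lemma nonconst_uminus [simp]: "nonconst (\<lambda>x. - h x) S \<longleftrightarrow> nonconst h S"
  unfolding nonconst_def by simp

lemma chain_edge: "chain V F u n \<Longrightarrow> i < n \<Longrightarrow> \<exists>E. F E \<and> u i \<in> E \<and> u (Suc i) \<in> E"
  unfolding chain_def by blast

lemma chain_vertex: "chain V F u n \<Longrightarrow> 0 < i \<Longrightarrow> i < n \<Longrightarrow> V (u i)"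
  unfolding chain_def by blast

lemma chain_0 [simp]: "chain V F u 0"
  unfolding chain_def by simp

lemma chain_take: "chain V F u n \<Longrightarrow> k \<le> n \<Longrightarrow> chain V F u k"
  unfolding chain_def by auto

lemma chain_shift: "chain V F u n \<Longrightarrow> chain V F (\<lambda>i. u (k + i)) (n - k)"
  unfolding chain_def by (auto simp: less_diff_conv add.commute)

lemma chain_rev:
  assumes "chain V F u n" shows "chain V F (\<lambda>i. u (n - i)) n"
  unfolding chain_def
proof (intro conjI allI impI)
  fix i assume "i < n"
  then have "Suc (n - Suc i) = n - i" "n - Suc i < n" by auto
  with chain_edge[OF assms, of "n - Suc i"] show "\<exists>E. F E \<and> u (n - i) \<in> E \<and> u (n - Suc i) \<in> E"
    by auto
next
  fix i assume "0 < i \<and> i < n"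
  with chain_vertex[OF assms, of "n - i"] show "V (u (n - i))" by auto
qed

lemma chain_start:
  assumes "chain V F u n" "F E" "q \<in> E" "u 1 \<in> E"
  shows "chain V F (u(0 := q)) n"
  using assms unfolding chain_def by (auto simp: fun_upd_def)

lemma chain_end:
  assumes "chain V F u n" "0 < n" "F E" "q \<in> E" "u (n - 1) \<in> E"
  shows "chain V F (u(n := q)) n"
  using assms unfolding chain_def by (auto simp: fun_upd_def)

lemma chain_Cons:
  assumes "chain V F u n" "V (u 0)" "F E" "x \<in> E" "u 0 \<in> E"
  shows "chain V F (case_nat x u) (Suc n)"
  using assms unfolding chain_def
  by (auto split: nat.split simp: less_Suc_eq_0_disj) (metis neq0_conv)

lemma ex_first_index: "P k \<Longrightarrow> \<exists>i\<le>k. P i \<and> (\<forall>h<i. \<not> P h)" for P :: "nat \<Rightarrow> bool"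
  by (metis Least_le LeastI not_less_Least)

lemma ex_last_index:
  fixes P :: "nat \<Rightarrow> bool"
  assumes "P k" "k \<le> n" shows "\<exists>j\<le>n. P j \<and> (\<forall>h. j < h \<and> h \<le> n \<longrightarrow> \<not> P h)"
proof -
  have "P (n - (n - k))" using assms by simp
  then obtain i where i: "P (n - i)" "\<And>h. h < i \<Longrightarrow> \<not> P (n - h)"
    using ex_first_index[of "\<lambda>i. P (n - i)" "n - k"] by blast
  have "\<not> P h" if "n - i < h" "h \<le> n" for h using i(2)[of "n - h"] that by simp
  then show ?thesis using i(1) by (intro exI[of _ "n - i"]) auto
qed

section \<open>Arithmetic of edge and jump counts\<close>

lemma of_bool_le1: "of_bool b \<le> (1::nat)"
  by simp

lemma cost_sum:
  "\<lbrakk>j + e \<le> e'; x + P \<le> P'; y + Q \<le> Q'\<rbrakk> \<Longrightarrow> j + x + y + (e + P + Q) \<le> e' + P' + Q'" for j :: nat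
  by linarith

text \<open>\<open>K - 1 - e\<close> is the number of jumps allotted to a climb of \<open>K\<close>
  edges. Passing \<open>j\<close> edges releases the jump they need when \<open>2 \<le> j\<close>;
  \<open>j < K\<close> and \<open>e \<le> 1\<close> keep truncated subtraction from spoiling the
  count.\<close>

lemma jump_count:
  fixes D :: nat
  assumes "0 < j" "j < K" "e \<le> 1"
  shows "(if 2 \<le> j then D else 0) + (K - j - 1 - e) * D \<le> (K - 1 - e) * D"
proof -
  have "of_bool (2 \<le> j) + (K - j - 1 - e) \<le> K - 1 - e" using assms by auto
  then have "(of_bool (2 \<le> j) + (K - j - 1 - e)) * D \<le> (K - 1 - e) * D"
    by (rule mult_right_mono) simp
  then show ?thesis by (auto simp: add_mult_distrib split: if_splits)
qed

text \<open>The geometry is axiomatised so that exchanging the factors or negating the levels gives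
  another instance. \<open>VA\<close> and \<open>FA\<close> stand for vertices and collinear faces
  of \<open>P\<close>, \<open>W x y\<close> for a vertex \<open>(x, y)\<close> of \<open>R\<close>,
  \<open>conn\<close> for a bound on distances in \<open>R\<close>, \<open>dA\<close> and
  \<open>DA\<close> for the diameters of \<open>A\<close> and of its stacked matrix.\<close>

locale climbing =
  fixes VA :: "'a \<Rightarrow> bool" and FA :: "'a set \<Rightarrow> bool" and f :: "'a \<Rightarrow> real" and dA DA :: nat
    and VB :: "'b \<Rightarrow> bool" and FB :: "'b set \<Rightarrow> bool" and g :: "'b \<Rightarrow> real" and dB DB :: nat
    and W :: "'a \<Rightarrow> 'b \<Rightarrow> bool" and conn :: "'a \<Rightarrow> 'b \<Rightarrow> 'a \<Rightarrow> 'b \<Rightarrow> nat \<Rightarrow> bool"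
  assumes betweenA: "\<lbrakk>FA E; p \<in> E; q \<in> E; f p \<le> t; t \<le> f q\<rbrakk> \<Longrightarrow> \<exists>r\<in>E. f r = t"
    and betweenB: "\<lbrakk>FB G; p' \<in> G; q' \<in> G; g p' \<le> t; t \<le> g q'\<rbrakk> \<Longrightarrow> \<exists>r\<in>G. g r = t"
    and injA: "\<lbrakk>FA E; nonconst f E; p \<in> E; q \<in> E; f p = f q\<rbrakk> \<Longrightarrow> p = q"
    and injB: "\<lbrakk>FB G; nonconst g G; p' \<in> G; q' \<in> G; g p' = g q'\<rbrakk> \<Longrightarrow> p' = q'"
    and topA: "\<lbrakk>FA E; nonconst f E; p \<in> E; f p < t; t \<notin> f ` E\<rbrakk>
      \<Longrightarrow> \<exists>v\<in>E. VA v \<and> f v < t \<and> (\<forall>r\<in>E. f r \<le> f v)"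
    and topB: "\<lbrakk>FB G; nonconst g G; p' \<in> G; g p' < t; t \<notin> g ` G\<rbrakk>
      \<Longrightarrow> \<exists>v\<in>G. VB v \<and> g v < t \<and> (\<forall>r\<in>G. g r \<le> g v)"
    and botA: "\<lbrakk>FA E; nonconst f E; p \<in> E; t < f p; t \<notin> f ` E\<rbrakk>
      \<Longrightarrow> \<exists>v\<in>E. VA v \<and> t < f v \<and> (\<forall>r\<in>E. f v \<le> f r)"
    and botB: "\<lbrakk>FB G; nonconst g G; p' \<in> G; t < g p'; t \<notin> g ` G\<rbrakk>
      \<Longrightarrow> \<exists>v\<in>G. VB v \<and> t < g v \<and> (\<forall>r\<in>G. g v \<le> g r)"
    and W_level: "W x y \<Longrightarrow> f x = g y"
    and W_vertices: "\<lbrakk>VA x; VB y; f x = g y\<rbrakk> \<Longrightarrow> W x y"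
    and W_edgeA: "\<lbrakk>FA E; nonconst f E; x \<in> E; VB y; f x = g y\<rbrakk> \<Longrightarrow> W x y"
    and W_edgeB: "\<lbrakk>FB G; nonconst g G; y \<in> G; VA x; f x = g y\<rbrakk> \<Longrightarrow> W x y"
    and W_cases: "W x y \<Longrightarrow> VA x \<or> VB y"
    and W_nonvertexA: "\<lbrakk>W x y; \<not> VA x\<rbrakk> \<Longrightarrow> \<exists>E w. FA E \<and> nonconst f E \<and> x \<in> E \<and> w \<in> E \<and> VA w"
    and W_nonvertexB: "\<lbrakk>W x y; \<not> VB y\<rbrakk> \<Longrightarrow> \<exists>G w. FB G \<and> nonconst g G \<and> y \<in> G \<and> w \<in> G \<and> VB w"
    and conn_refl: "conn x y x y 0"
    and conn_trans: "\<lbrakk>conn x y x' y' m; conn x' y' x'' y'' n\<rbrakk> \<Longrightarrow> conn x y x'' y'' (m + n)"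
    and conn_mono: "\<lbrakk>conn x y x' y' m; m \<le> n\<rbrakk> \<Longrightarrow> conn x y x' y' n"
    and conn_sym: "conn x y x' y' n \<Longrightarrow> conn x' y' x y n"
    and tandem: "\<lbrakk>W x y; W x' y'; FA E; x \<in> E; x' \<in> E; FB G; y \<in> G; y' \<in> G;
      nonconst f E \<or> nonconst g G\<rbrakk> \<Longrightarrow> conn x y x' y' 1"
    and jumpA: "\<lbrakk>VB y; W x y; W x' y\<rbrakk> \<Longrightarrow> conn x y x' y DA"
    and jumpB: "\<lbrakk>VA x; W x y; W x y'\<rbrakk> \<Longrightarrow> conn x y x y' DB"
    and pathA: "\<lbrakk>VA v; VA w\<rbrakk> \<Longrightarrow> \<exists>n\<le>dA. \<exists>u. chain VA FA u n \<and> u 0 = v \<and> u n = w"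
    and pathB: "\<lbrakk>VB v'; VB w'\<rbrakk> \<Longrightarrow> \<exists>n\<le>dB. \<exists>u. chain VB FB u n \<and> u 0 = v' \<and> u n = w'"
    and dA_0: "dA = 0 \<Longrightarrow> DA \<le> 1"
    and dB_0: "dB = 0 \<Longrightarrow> DB \<le> 1"
begin

lemma climbing_swap:
  "climbing VB FB g dB DB VA FA f dA DA (\<lambda>y x. W x y) (\<lambda>y x y' x'. conn x y x' y')"
  by unfold_locales
    ((rule betweenB betweenA injB injA topB topA botB botA W_level[symmetric] W_vertices W_edgeB W_edgeA
      W_nonvertexB W_nonvertexA conn_refl conn_trans conn_mono conn_sym jumpB jumpA pathB pathA dB_0 dA_0;
      (assumption | simp)?; fail) | (use W_cases tandem in blast))+

text \<open>Negation trades \<open>topA\<close> for \<open>botA\<close>; it serves endpoints whose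
  edges are unbounded below.\<close>

lemma climbing_flip:
  "climbing VA FA (\<lambda>x. - f x) dA DA VB FB (\<lambda>y. - g y) dB DB W conn"
proof unfold_locales
  show "\<exists>r\<in>E. - f r = t" if "FA E" "p \<in> E" "q \<in> E" "- f p \<le> t" "t \<le> - f q" for E p q t
  proof -
    have "f q \<le> - t" "- t \<le> f p" using that by auto
    then show ?thesis using betweenA[of E q p "- t"] that by (metis minus_minus)
  qed
  show "\<exists>r\<in>E. - g r = t" if "FB E" "p \<in> E" "q \<in> E" "- g p \<le> t" "t \<le> - g q" for E p q t
  proof -
    have "g q \<le> - t" "- t \<le> g p" using that by auto
    then show ?thesis using betweenB[of E q p "- t"] that by (metis minus_minus)
  qed
  show "\<exists>v\<in>E. VA v \<and> - f v < t \<and> (\<forall>r\<in>E. - f r \<le> - f v)"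
    if "FA E" "nonconst (\<lambda>x. - f x) E" "p \<in> E" "- f p < t" "t \<notin> (\<lambda>x. - f x) ` E" for E p t
    using botA[of E p "- t"] that by force
  show "\<exists>v\<in>E. VB v \<and> - g v < t \<and> (\<forall>r\<in>E. - g r \<le> - g v)"
    if "FB E" "nonconst (\<lambda>x. - g x) E" "p \<in> E" "- g p < t" "t \<notin> (\<lambda>x. - g x) ` E" for E p t
    using botB[of E p "- t"] that by force
  show "\<exists>v\<in>E. VA v \<and> t < - f v \<and> (\<forall>r\<in>E. - f v \<le> - f r)"
    if "FA E" "nonconst (\<lambda>x. - f x) E" "p \<in> E" "t < - f p" "t \<notin> (\<lambda>x. - f x) ` E" for E p t
    using topA[of E p "- t"] that by force
  show "\<exists>v\<in>E. VB v \<and> t < - g v \<and> (\<forall>r\<in>E. - g v \<le> - g r)"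
    if "FB E" "nonconst (\<lambda>x. - g x) E" "p \<in> E" "t < - g p" "t \<notin> (\<lambda>x. - g x) ` E" for E p t
    using topB[of E p "- t"] that by force
qed ((unfold nonconst_uminus neg_equal_iff_equal)?,
  (rule injA injB W_level W_vertices W_edgeA W_edgeB W_cases W_nonvertexA W_nonvertexB conn_refl
    conn_trans conn_mono conn_sym tandem jumpA jumpB pathA pathB dA_0 dB_0; assumption))+

text \<open>Each intermediate vertex of the chain pairs with the point of \<open>G\<close> at its
  level to a vertex of \<open>R\<close>, so every step is a tandem move.\<close>

lemma follow_within:
  assumes "FB G" "nonconst g G" "chain VA FA u n" "\<And>i. i \<le> n \<Longrightarrow> f (u i) \<in> g ` G"
    and "y \<in> G" "y' \<in> G" "W (u 0) y" "W (u n) y'"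
  shows "conn (u 0) y (u n) y' n"
  using assms(3-8)
proof (induction n arbitrary: y')
  case 0
  then have "y = y'" using injB[OF assms(1,2)] W_level by metis
  then show ?case using conn_refl by simp
next
  case (Suc n)
  obtain E where E: "FA E" "u n \<in> E" "u (Suc n) \<in> E"
    using chain_edge[OF Suc.prems(1), of n] by blast
  show ?case
  \<comment> \<open>\<open>u 0\<close> need not be a vertex, so the first step starts from the given
    pair.\<close>
  proof (cases "n = 0")
    case True
    then show ?thesis using tandem[OF Suc.prems(5,6), of E G] E assms Suc.prems by auto
  next
    case False
    then have V: "VA (u n)" using chain_vertex[OF Suc.prems(1)] by simp
    obtain z where z: "z \<in> G" "f (u n) = g z" using Suc.prems(2)[of n] by auto
    have Wz: "W (u n) z" using W_edgeB[OF assms(1,2) z(1) V z(2)] .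
    have "conn (u 0) y (u n) z n"
      using Suc.IH[of z] chain_take[OF Suc.prems(1), of n] Suc.prems(2-5) z Wz by auto
    moreover have "conn (u n) z (u (Suc n)) y' 1"
      using tandem[OF Wz Suc.prems(6) E assms(1) z(1) Suc.prems(4)] assms(2) by blast
    ultimately show ?thesis using conn_trans by fastforce
  qed
qed

text \<open>If the chain rises above the edge \<open>G\<close>, the intermediate part is skipped by a jump made while
  the second component waits at the upper end of \<open>G\<close>.\<close>

lemma follow:
  assumes G: "FB G" "nonconst g G" and u: "chain VA FA u n"
    and low: "\<And>i. i \<le> n \<Longrightarrow> f (u 0) \<le> f (u i)"
    and y: "y \<in> G" "y' \<in> G" "W (u 0) y" "W (u n) y'"
  shows "conn (u 0) y (u n) y' (n + (if 2 \<le> n then DA else 0))"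
proof (cases "\<forall>i\<le>n. f (u i) \<in> g ` G")
  case True
  then have "conn (u 0) y (u n) y' n" using follow_within[OF G u _ y] by blast
  then show ?thesis by (rule conn_mono) simp
next
  case False
  then obtain k where k: "k \<le> n" "f (u k) \<notin> g ` G" by blast
  have lev: "f (u 0) = g y" "f (u n) = g y'" using y(3,4) W_level by auto
  have "g y < f (u k)" using low[OF k(1)] k(2) lev y by (metis image_eqI order_le_less)
  \<comment> \<open>\<open>G\<close> misses a level above \<open>g y\<close>, so it has an upper end
    \<open>v\<close>, a vertex.\<close>
  then obtain v where v: "v \<in> G" "VB v" "g v < f (u k)" "\<And>r. r \<in> G \<Longrightarrow> g r \<le> g v"
    using topB[OF G y(1)] k(2) by blast
  have below: "f (u i) \<in> g ` G" if "i \<le> n" "f (u i) \<le> g v" for i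
    using betweenB[OF G(1) y(1) v(1), of "f (u i)"] low[OF that(1)] that(2) lev by (metis image_eqI)
  obtain i where i: "i \<le> k" "g v < f (u i)" and before: "\<And>h. h < i \<Longrightarrow> f (u h) \<le> g v"
    using ex_first_index[of "\<lambda>i. g v < f (u i)" k] v(3) by (auto simp: not_less)
  obtain j where j: "j \<le> n" "g v < f (u j)" and after: "\<And>h. j < h \<Longrightarrow> h \<le> n \<Longrightarrow> f (u h) \<le> g v"
    using ex_last_index[of "\<lambda>i. g v < f (u i)" k n] v(3) k(1) by (auto simp: not_less)
  have ij: "i \<le> j" using before[of j] j(2) by (force simp: not_less[symmetric])
  have i0: "0 < i" using i v(4)[OF y(1)] lev by (cases i) auto
  have jn: "j < n" using j v(4)[OF y(2)] lev by (cases "j = n") auto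
  \<comment> \<open>The edge into \<open>u i\<close> and the edge out of \<open>u j\<close> cross
    the level \<open>g v\<close> at \<open>p\<close> and \<open>q\<close>. Both pair with
    \<open>v\<close>, so one jump replaces the part in between.\<close>
  obtain E where E: "FA E" "u (i - 1) \<in> E" "u i \<in> E"
    using chain_edge[OF u, of "i - 1"] i0 ij jn by (metis Suc_diff_1 Suc_pred' le_less_trans less_imp_diff_less)
  have ui: "f (u (i - 1)) \<le> g v" "g v < f (u i)" using before[of "i - 1"] i0 i by auto
  obtain p where p: "p \<in> E" "f p = g v" using betweenA[OF E, of "g v"] ui by auto
  have Wp: "W p v" using W_edgeA[OF E(1) nonconstI[OF E(2,3)] p(1) v(2) p(2)] ui by auto
  obtain E' where E': "FA E'" "u j \<in> E'" "u (Suc j) \<in> E'"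
    using chain_edge[OF u jn] by auto
  have uj: "f (u (Suc j)) \<le> g v" "g v < f (u j)" using after[of "Suc j"] jn j by auto
  obtain q where q: "q \<in> E'" "f q = g v" using betweenA[OF E'(1,3,2), of "g v"] uj by auto
  have Wq: "W q v" using W_edgeA[OF E'(1) nonconstI[OF E'(2,3)] q(1) v(2) q(2)] uj by auto
  have "conn ((u(i := p)) 0) y ((u(i := p)) i) v i"
  proof (rule follow_within[OF G])
    show "chain VA FA (u(i := p)) i"
      using chain_end[OF chain_take[OF u] i0 E(1) p(1) E(2)] ij jn by simp
    show "f ((u(i := p)) h) \<in> g ` G" if "h \<le> i" for h
      using that below[of h] before[of h] p v ij jn by auto
  qed (use y v Wp i0 in auto)
  then have 1: "conn (u 0) y p v i" using i0 by simp
  let ?w = "(\<lambda>h. u (j + h))(0 := q)"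
  have "conn (?w 0) v (?w (n - j)) y' (n - j)"
  proof (rule follow_within[OF G])
    show "chain VA FA ?w (n - j)"
      using chain_start[OF chain_shift[OF u] E'(1) q(1)] E'(3) by simp
    show "f (?w h) \<in> g ` G" if "h \<le> n - j" for h
      using that below[of "j + h"] after[of "j + h"] q v jn by auto
  qed (use y v Wq jn in auto)
  then have 2: "conn q v (u n) y' (n - j)" using jn by simp
  have "conn (u 0) y (u n) y' ((i + DA) + (n - j))"
    by (rule conn_trans[OF conn_trans[OF 1 jumpA[OF v(2) Wp Wq]] 2])
  \<comment> \<open>\<open>0 < i \<le> j < n\<close> gives \<open>2 \<le> n\<close>, so the jump is
    accounted for, and \<open>i + (n - j) \<le> n\<close>.\<close>
  then show ?thesis by (rule conn_mono) (use ij i0 jn in auto)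
qed

section \<open>Climbing above a common starting level\<close>

text \<open>By the last two conditions a non-vertex end is higher than the point before it; hence it
  can be the lowest of the later points only if its chain has a single edge.\<close>

definition rising :: "(nat \<Rightarrow> 'a) \<Rightarrow> nat \<Rightarrow> (nat \<Rightarrow> 'b) \<Rightarrow> nat \<Rightarrow> bool" where
  "rising u K v L \<longleftrightarrow> 1 \<le> K \<and> 1 \<le> L \<and> chain VA FA u K \<and> chain VB FB v L
    \<and> (\<forall>i. 0 < i \<and> i \<le> K \<longrightarrow> f (u 0) < f (u i)) \<and> (\<forall>i. 0 < i \<and> i \<le> L \<longrightarrow> g (v 0) < g (v i))
    \<and> W (u 0) (v 0) \<and> W (u K) (v L)
    \<and> (\<not> VA (u K) \<longrightarrow> f (u (K - 1)) < f (u K)) \<and> (\<not> VB (v L) \<longrightarrow> g (v (L - 1)) < g (v L))"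

text \<open>Both chains arrive at their ends simultaneously, which saves one edge. A chain of
  \<open>K\<close> edges is charged \<open>K - 1\<close> jumps, and one fewer if it ends in a
  non-vertex.\<close>

definition climb_cost :: "'a \<Rightarrow> nat \<Rightarrow> 'b \<Rightarrow> nat \<Rightarrow> nat" where
  "climb_cost x K y L = K + L - 1 + (K - 1 - of_bool (\<not> VA x)) * DA + (L - 1 - of_bool (\<not> VB y)) * DB"

text \<open>The induction step when the lowest later level \<open>s\<close> of both chains is
  attained on \<open>u\<close>: the pair moves to the last visit of \<open>s\<close>, after which
  \<open>u\<close> stays strictly above \<open>s\<close>.\<close>

lemma climb_step:
  assumes IH: "\<And>u' v' K' L'. K' + L' < K + L \<Longrightarrow> rising u' K' v' L'
      \<Longrightarrow> conn (u' 0) (v' 0) (u' K') (v' L') (climb_cost (u' K') K' (v' L') L')"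
    and ris: "rising u K v L"
    and k: "0 < k" "k \<le> K" "\<And>i. 0 < i \<Longrightarrow> i \<le> K \<Longrightarrow> f (u k) \<le> f (u i)"
      "\<And>i. 0 < i \<Longrightarrow> i \<le> L \<Longrightarrow> f (u k) \<le> g (v i)"
  shows "conn (u 0) (v 0) (u K) (v L) (climb_cost (u K) K (v L) L)"
proof -
  have KL: "1 \<le> K" "1 \<le> L" and u: "chain VA FA u K" and v: "chain VB FB v L"
    and up: "\<And>i. 0 < i \<Longrightarrow> i \<le> K \<Longrightarrow> f (u 0) < f (u i)" "\<And>i. 0 < i \<Longrightarrow> i \<le> L \<Longrightarrow> g (v 0) < g (v i)"
    and W0: "W (u 0) (v 0)" and W1: "W (u K) (v L)"
    and last: "\<not> VA (u K) \<Longrightarrow> f (u (K - 1)) < f (u K)" "\<not> VB (v L) \<Longrightarrow> g (v (L - 1)) < g (v L)"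
    using ris unfolding rising_def by auto
  define s where "s = f (u k)"
  have lev0: "f (u 0) = g (v 0)" and lev1: "f (u K) = g (v L)" using W0 W1 W_level by auto
  have s0: "f (u 0) < s" using up(1) k unfolding s_def by auto
  obtain j where j: "0 < j" "j \<le> K" "f (u j) = s" and jlast': "\<And>h. j < h \<Longrightarrow> h \<le> K \<Longrightarrow> f (u h) \<noteq> s"
    using ex_last_index[of "\<lambda>i. 0 < i \<and> f (u i) = s" k K] k unfolding s_def by auto
  have jlast: "s < f (u i)" if "j < i" "i \<le> K" for i
    using jlast'[OF that] k(3)[of i] that unfolding s_def by force
  obtain E where E: "FA E" "u 0 \<in> E" "u 1 \<in> E" using chain_edge[OF u, of 0] KL by auto
  have Enc: "nonconst f E" using nonconstI[OF E(2,3)] up(1)[of 1] KL by fastforce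
  obtain G where G: "FB G" "v 0 \<in> G" "v 1 \<in> G" using chain_edge[OF v, of 0] KL by auto
  have Gnc: "nonconst g G" using nonconstI[OF G(2,3)] up(2)[of 1] KL by fastforce
  obtain q where q: "q \<in> G" "g q = s"
    using betweenB[OF G, of s] s0 lev0 k(4)[of 1] KL unfolding s_def by auto
  show ?thesis
  proof (cases "VA (u j)")
    \<comment> \<open>A non-vertex \<open>u j\<close> is the end of \<open>u\<close>, and being
      lowest it forces \<open>K = 1\<close>. The roles are then exchanged: \<open>v\<close> follows
      the single edge \<open>E\<close>.\<close>
    case False
    then have "j = K" using chain_vertex[OF u j(1)] j(2) by fastforce
    with False last(1) j have "f (u (K - 1)) < s" by auto
    then have K1: "K = 1" using k(3)[of "K - 1"] KL unfolding s_def by fastforce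
    have vL: "VB (v L)" using W_cases[OF W1] False \<open>j = K\<close> by simp
    interpret sw: climbing VB FB g dB DB VA FA f dA DA "\<lambda>y x. W x y" "\<lambda>y x y' x'. conn x y x' y'"
      by (rule climbing_swap)
    have "conn (u 0) (v 0) (u 1) (v L) (L + (if 2 \<le> L then DB else 0))"
    proof (rule sw.follow[OF E(1) Enc v _ E(2,3) W0])
      show "g (v 0) \<le> g (v i)" if "i \<le> L" for i using that up(2)[of i] by (cases "i = 0") auto
      show "W (u 1) (v L)" using W1 K1 by simp
    qed
    then have "conn (u 0) (v 0) (u K) (v L) (L + (if 2 \<le> L then DB else 0))" using K1 by simp
    then show ?thesis by (rule conn_mono) (use K1 vL in \<open>auto simp: climb_cost_def\<close>)
  next
    case True
    have Wq: "W (u j) q" using W_edgeB[OF G(1) Gnc q(1) True] j q by simp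
    have 1: "conn (u 0) (v 0) (u j) q (j + (if 2 \<le> j then DA else 0))"
    proof (rule follow[OF G(1) Gnc chain_take[OF u j(2)] _ G(2) q(1) W0 Wq])
      show "f (u 0) \<le> f (u i)" if "i \<le> j" for i using that up(1)[of i] j by (cases "i = 0") auto
    qed
    show ?thesis
    proof (cases "\<exists>i. 0 < i \<and> i \<le> L \<and> g (v i) = s")
      case False
      then have vs: "s < g (v i)" if "0 < i" "i \<le> L" for i using that k(4)[of i] unfolding s_def by force
      have jK: "j < K" using j vs[of L] lev1 KL by (cases "j = K") auto
      \<comment> \<open>The climb continues from \<open>q\<close> inside the first edge of
        \<open>v\<close>, so only \<open>u\<close> gets shorter.\<close>
      let ?u = "\<lambda>i. u (j + i)" and ?v = "v(0 := q)"
      have "rising ?u (K - j) ?v L"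
        unfolding rising_def
      proof (intro conjI)
        show "chain VA FA ?u (K - j)" using u by (rule chain_shift)
        show "chain VB FB ?v L" using v G(1) q(1) G(3) by (rule chain_start)
        show "\<not> VB (?v L) \<longrightarrow> g (?v (L - 1)) < g (?v L)"
          using last(2) KL vs[of L] q by auto
        show "\<not> VA (?u (K - j)) \<longrightarrow> f (?u (K - j - 1)) < f (?u (K - j))" using last(1) jK by auto
      qed (use jK KL j jlast vs q Wq W1 in auto)
      then have "conn (?u 0) (?v 0) (?u (K - j)) (?v L) (climb_cost (?u (K - j)) (K - j) (?v L) L)"
        by (rule IH[rotated]) (use j in auto)
      then have 2: "conn (u j) q (u K) (v L) (climb_cost (u K) (K - j) (v L) L)" using jK KL by simp
      show ?thesis
      proof (rule conn_mono[OF conn_trans[OF 1 2]])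
        show "j + (if 2 \<le> j then DA else 0) + climb_cost (u K) (K - j) (v L) L
          \<le> climb_cost (u K) K (v L) L"
          unfolding climb_cost_def
          by (rule cost_sum[where y = 0, simplified, OF _ jump_count[OF j(1) jK of_bool_le1]])
            (use j jK KL in auto)
      qed
    next
      case True': True
      obtain i where i: "0 < i" "i \<le> L" "g (v i) = s"
        and ilast': "\<And>h. i < h \<Longrightarrow> h \<le> L \<Longrightarrow> g (v h) \<noteq> s"
      proof -
        obtain h where "0 < h \<and> g (v h) = s" "h \<le> L" using True' by blast
        from ex_last_index[of "\<lambda>i. 0 < i \<and> g (v i) = s", OF this] that show ?thesis by auto
      qed
      have ilast: "s < g (v h)" if "i < h" "h \<le> L" for h
        using ilast'[OF that] k(4)[of h] that unfolding s_def by force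
      have ends: "j = K \<longleftrightarrow> i = L" using i j ilast[of L] jlast[of K] lev1 KL by force
      have nonv: "i = L \<and> L = 1" if "\<not> VB (v i)"
      proof -
        have "i = L" using chain_vertex[OF v i(1)] i(2) that by fastforce
        with that last(2) i have "g (v (L - 1)) < s" by auto
        then show ?thesis using k(4)[of "L - 1"] KL \<open>i = L\<close> unfolding s_def by fastforce
      qed
      have Wi: "W (u j) (v i)"
        using W_vertices[OF True, of "v i"] nonv i j W1 ends by metis
      \<comment> \<open>At the vertex \<open>u j\<close> the second component jumps from
        \<open>q\<close> to \<open>v i\<close>. For \<open>i = 1\<close> both lie on
        \<open>G\<close> at the same level and coincide.\<close>
      have 2: "conn (u j) q (u j) (v i) (if 2 \<le> i then DB else 0)"
      proof (cases "2 \<le> i")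
        case True'': True
        then show ?thesis using jumpB[OF True Wq Wi] by simp
      next
        case False
        then have "i = 1" using i by simp
        then have "q = v i" using injB[OF G(1) Gnc q(1) G(3)] q i by simp
        then show ?thesis using conn_refl False by simp
      qed
      note 3 = conn_trans[OF 1 2]
      show ?thesis
      proof (cases "j = K")
        case jK: True
        then have iL: "i = L" using ends by simp
        have "(if 2 \<le> K then DA else 0) \<le> (K - 1 - of_bool (\<not> VA (u K))) * DA"
          using True jK mult_le_mono1[of 1 "K - 1" DA] by auto
        moreover have "(if 2 \<le> L then DB else 0) \<le> (L - 1 - of_bool (\<not> VB (v L))) * DB"
          using nonv iL mult_le_mono1[of 1 "L - 1" DB] by auto
        ultimately show ?thesis
          using KL unfolding climb_cost_def by (intro conn_mono[OF 3[unfolded jK iL]]) linarith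
      next
        case False
        then have jK: "j < K" and iL: "i < L" using ends i j by auto
        let ?u = "\<lambda>h. u (j + h)" and ?v = "\<lambda>h. v (i + h)"
        have "rising ?u (K - j) ?v (L - i)"
          unfolding rising_def
        proof (intro conjI)
          show "chain VA FA ?u (K - j)" using u by (rule chain_shift)
          show "chain VB FB ?v (L - i)" using v by (rule chain_shift)
          show "\<not> VA (?u (K - j)) \<longrightarrow> f (?u (K - j - 1)) < f (?u (K - j))" using last(1) jK by auto
          show "\<not> VB (?v (L - i)) \<longrightarrow> g (?v (L - i - 1)) < g (?v (L - i))" using last(2) iL by auto
        qed (use jK iL i j jlast ilast Wi W1 in auto)
        then have "conn (?u 0) (?v 0) (?u (K - j)) (?v (L - i))
            (climb_cost (?u (K - j)) (K - j) (?v (L - i)) (L - i))"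
          by (rule IH[rotated]) (use j jK iL in auto)
        then have 4: "conn (u j) (v i) (u K) (v L) (climb_cost (u K) (K - j) (v L) (L - i))"
          using jK iL by simp
        show ?thesis
        proof (rule conn_mono[OF conn_trans[OF 3 4]])
          show "j + (if 2 \<le> j then DA else 0) + (if 2 \<le> i then DB else 0)
            + climb_cost (u K) (K - j) (v L) (L - i) \<le> climb_cost (u K) K (v L) L"
            unfolding climb_cost_def
            by (rule cost_sum[OF _ jump_count[OF j(1) jK of_bool_le1] jump_count[OF i(1) iL of_bool_le1]])
              (use j jK iL in linarith)
        qed
      qed
    qed
  qed
qed

text \<open>Induction on the total number of edges; the factor attaining the lowest later level
  plays the first role in \<open>climb_step\<close>.\<close>

lemma climb:
  "rising u K v L \<Longrightarrow> conn (u 0) (v 0) (u K) (v L) (climb_cost (u K) K (v L) L)"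
proof (induction "K + L" arbitrary: u v K L rule: less_induct)
  case less
  have KL: "1 \<le> K" "1 \<le> L" using less.prems unfolding rising_def by auto
  have "Min ((\<lambda>i. f (u i)) ` {1..K}) \<in> (\<lambda>i. f (u i)) ` {1..K}" by (rule Min_in) (use KL in auto)
  then obtain k where k: "k \<in> {1..K}" "f (u k) = Min ((\<lambda>i. f (u i)) ` {1..K})" by (auto simp del: Min_in)
  have "Min ((\<lambda>i. g (v i)) ` {1..L}) \<in> (\<lambda>i. g (v i)) ` {1..L}" by (rule Min_in) (use KL in auto)
  then obtain l where l: "l \<in> {1..L}" "g (v l) = Min ((\<lambda>i. g (v i)) ` {1..L})" by (auto simp del: Min_in)
  have kmin: "f (u k) \<le> f (u i)" if "0 < i" "i \<le> K" for i using k that by auto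
  have lmin: "g (v l) \<le> g (v i)" if "0 < i" "i \<le> L" for i using l that by auto
  show ?case
  proof (cases "f (u k) \<le> g (v l)")
    case True
    show ?thesis
    proof (rule climb_step[OF less.hyps less.prems _ _ kmin])
      show "f (u k) \<le> g (v i)" if "0 < i" "i \<le> L" for i using lmin[OF that] True by simp
    qed (use k in auto)
  next
    case False
    interpret sw: climbing VB FB g dB DB VA FA f dA DA "\<lambda>y x. W x y" "\<lambda>y x y' x'. conn x y x' y'"
      by (rule climbing_swap)
    have ris: "sw.rising v' L' u' K' \<longleftrightarrow> rising u' K' v' L'" for u' v' K' L'
      unfolding rising_def sw.rising_def by auto
    have cost: "sw.climb_cost y L' x K' = climb_cost x K' y L'" for x y K' L'
      unfolding climb_cost_def sw.climb_cost_def by (simp add: add.commute add.left_commute)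
    show ?thesis unfolding cost[symmetric]
    proof (rule sw.climb_step[OF _ less.prems[folded ris] _ _ lmin], unfold ris cost)
      show "conn (u' 0) (v' 0) (u' K') (v' L') (climb_cost (u' K') K' (v' L') L')"
        if "L' + K' < L + K" "rising u' K' v' L'" for u' v' K' L'
        using less.hyps[of K' L' u' v'] that by (simp add: add.commute)
      show "g (v l) \<le> f (u i)" if "0 < i" "i \<le> K" for i using kmin[OF that] False by simp
    qed (use l in auto)
  qed
qed

section \<open>Gluing two climbs in a valley\<close>

text \<open>The chains \<open>p\<close> and \<open>p'\<close> ascend from level \<open>m\<close>, the lowest level of the chain \<open>v\<close>, to
  the two endpoints.  The first lowest point of \<open>v\<close> is reached by reversing a climb; there the first
  component jumps from \<open>p 0\<close> to \<open>p' 0\<close>.\<close>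

lemma valley:
  assumes p: "chain VA FA p K" "f (p 0) = m" "\<And>i. 0 < i \<Longrightarrow> i \<le> K \<Longrightarrow> m < f (p i)"
      "\<not> VA (p K) \<Longrightarrow> 0 < K \<Longrightarrow> f (p (K - 1)) < f (p K)"
    and p': "chain VA FA p' K'" "f (p' 0) = m" "\<And>i. 0 < i \<Longrightarrow> i \<le> K' \<Longrightarrow> m < f (p' i)"
      "\<not> VA (p' K') \<Longrightarrow> 0 < K' \<Longrightarrow> f (p' (K' - 1)) < f (p' K')"
    and v: "chain VB FB v L" "\<And>i. i \<le> L \<Longrightarrow> m \<le> g (v i)" "k \<le> L" "g (v k) = m"
      "\<not> VB (v 0) \<Longrightarrow> 0 < L \<and> g (v 1) < g (v 0)"
      "\<not> VB (v L) \<Longrightarrow> 0 < L \<and> g (v (L - 1)) < g (v L)"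
    and W: "W (p K) (v 0)" "W (p' K') (v L)"
  obtains i j where "i \<le> j" "j \<le> L" "K = 0 \<longleftrightarrow> i = 0" "K' = 0 \<longleftrightarrow> j = L"
    "\<not> VB (v 0) \<Longrightarrow> 0 < i" "\<not> VB (v L) \<Longrightarrow> j < L"
    "conn (p K) (v 0) (p' K') (v L) (climb_cost (p K) K (v 0) i + (if p 0 = p' 0 then 0 else DA)
      + (j - i + (if i = j then 0 else DB)) + climb_cost (p' K') K' (v L) (L - j))"
proof -
  obtain i where i: "i \<le> k" "g (v i) = m" and before': "\<And>h. h < i \<Longrightarrow> g (v h) \<noteq> m"
    using ex_first_index[of "\<lambda>i. g (v i) = m" k] v(4) by auto
  obtain j where j: "j \<le> L" "g (v j) = m" and after': "\<And>h. j < h \<Longrightarrow> h \<le> L \<Longrightarrow> g (v h) \<noteq> m"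
    using ex_last_index[of "\<lambda>i. g (v i) = m" k L] v(3,4) by auto
  have ij: "i \<le> j" using before'[of j] j by force
  have before: "m < g (v h)" if "h < i" for h using before'[OF that] v(2)[of h] that i v(3) by force
  have after: "m < g (v h)" if "j < h" "h \<le> L" for h using after'[OF that] v(2)[of h] that by force
  have lev: "f (p K) = g (v 0)" "f (p' K') = g (v L)" using W W_level by auto
  have K0: "K = 0 \<longleftrightarrow> i = 0"
    using lev(1) p(2) p(3)[of K] before[of 0] i(2) by (cases "K = 0"; cases "i = 0") auto
  have K'0: "K' = 0 \<longleftrightarrow> j = L"
    using lev(2) p'(2) p'(3)[of K'] after[of L] j by (cases "K' = 0"; cases "j = L") auto
  have nv0: "0 < i" if "\<not> VB (v 0)" using v(5)[OF that] v(2)[of 1] i by (cases "i = 0") auto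
  have nvL: "j < L" if "\<not> VB (v L)" using v(6)[OF that] v(2)[of "L - 1"] j by (cases "j = L") auto
  \<comment> \<open>A non-vertex end of \<open>v\<close> has a strictly lower neighbour, so it is
    never at the minimal level.\<close>
  have VB_min: "VB (v h)" if h: "h \<le> L" "g (v h) = m" for h
  proof (rule ccontr)
    assume n: "\<not> VB (v h)"
    consider "h = 0" | "h = L" | "0 < h" "h < L" using h(1) by linarith
    then show False
      using n h v(5,6) v(2)[of 1] v(2)[of "L - 1"] chain_vertex[OF v(1), of h] by cases auto
  qed
  have Vi: "VB (v i)" and Vj: "VB (v j)" using VB_min i j v(3) by auto
  \<comment> \<open>For \<open>n = 0\<close> the point \<open>q 0\<close> is already a component of
    a vertex of \<open>R\<close>; otherwise it starts an edge of varying level. Either way it pairs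
    with every vertex at level \<open>m\<close>.\<close>
  have Wstart: "W (q 0) y" if q: "chain VA FA q n" "f (q 0) = m" "\<And>i. 0 < i \<Longrightarrow> i \<le> n \<Longrightarrow> m < f (q i)"
    "W (q n) z" and y: "VB y" "g y = m" for q n y z
  proof (cases "n = 0")
    case True
    show ?thesis
      using W_vertices[of "q 0" y] W_nonvertexA[OF q(4)] W_edgeA[of _ "q 0" y] True q(2) y by metis
  next
    case False
    obtain E where E: "FA E" "q 0 \<in> E" "q 1 \<in> E" using chain_edge[OF q(1), of 0] False by auto
    have "f (q 0) \<noteq> f (q 1)" using q(3)[of 1] False q(2) by auto
    then show ?thesis using W_edgeA[OF E(1) nonconstI[OF E(2,3)] E(2) y(1)] q(2) y by simp
  qed
  note Wp = Wstart[OF p(1-3) W(1)] and Wp' = Wstart[OF p'(1-3) W(2)]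
  have 1: "conn (p K) (v 0) (p 0) (v i) (climb_cost (p K) K (v 0) i)"
  proof (cases "K = 0")
    case True
    then show ?thesis using K0 conn_mono[OF conn_refl] by simp
  next
    case False
    let ?v = "\<lambda>h. v (i - h)"
    have "rising p K ?v i"
      unfolding rising_def
    proof (intro conjI)
      show "chain VB FB ?v i" using chain_rev[OF chain_take[OF v(1)]] i v(3) by simp
      show "\<not> VB (?v i) \<longrightarrow> g (?v (i - 1)) < g (?v i)" using v(5) K0 False by auto
    qed (use p False K0 before i W Wp Vi in auto)
    from conn_sym[OF climb[OF this]] show ?thesis by simp
  qed
  have 2: "conn (p 0) (v i) (p' 0) (v i) (if p 0 = p' 0 then 0 else DA)"
    using jumpA[OF Vi Wp Wp'] Vi i conn_refl by auto
  \<comment> \<open>From a vertex \<open>p' 0\<close> one jump suffices. If \<open>p' 0\<close> lies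
    inside an edge, the second component walks along \<open>v\<close> while the first moves on that
    edge and returns.\<close>
  have 3: "conn (p' 0) (v i) (p' 0) (v j) (j - i + (if i = j then 0 else DB))"
  proof (cases "i = j")
    case True
    then show ?thesis using conn_refl by simp
  next
    case False
    show ?thesis
    proof (cases "VA (p' 0)")
      case True
      show ?thesis by (rule conn_mono[OF jumpB[OF True Wp' Wp']]) (use Vi Vj i j False in auto)
    next
      case nv: False
      obtain E where E: "FA E" "nonconst f E" "p' 0 \<in> E" using W_nonvertexA[OF Wp' nv] Vi i by blast
      interpret sw: climbing VB FB g dB DB VA FA f dA DA "\<lambda>y x. W x y" "\<lambda>y x y' x'. conn x y x' y'"
        by (rule climbing_swap)
      let ?v = "\<lambda>h. v (i + h)"
      have "conn (p' 0) (?v 0) (p' 0) (?v (j - i)) (j - i + (if 2 \<le> j - i then DB else 0))"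
      proof (rule sw.follow[OF E(1,2) _ _ E(3,3)])
        show "chain VB FB ?v (j - i)" using chain_take[OF chain_shift[OF v(1)]] j by simp
        show "g (?v 0) \<le> g (?v h)" if "h \<le> j - i" for h using that v(2)[of "i + h"] i j ij by auto
      qed (use Wp' Vi Vj i j ij in auto)
      then have "conn (p' 0) (v i) (p' 0) (v j) (j - i + (if 2 \<le> j - i then DB else 0))" using ij by simp
      then show ?thesis by (rule conn_mono) (use False in auto)
    qed
  qed
  have 4: "conn (p' 0) (v j) (p' K') (v L) (climb_cost (p' K') K' (v L) (L - j))"
  proof (cases "K' = 0")
    case True
    then show ?thesis using K'0 conn_mono[OF conn_refl] by simp
  next
    case False
    let ?v = "\<lambda>h. v (j + h)"
    have jL: "j < L" using K'0 False j by simp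
    have "rising p' K' ?v (L - j)"
      unfolding rising_def
    proof (intro conjI)
      show "chain VB FB ?v (L - j)" using chain_shift[OF v(1)] .
      show "\<not> VB (?v (L - j)) \<longrightarrow> g (?v (L - j - 1)) < g (?v (L - j))" using v(6) jL by auto
    qed (use p' False jL after j W Wp' Vj in auto)
    from climb[OF this] show ?thesis using jL by simp
  qed
  show thesis
    by (rule that[OF ij j(1) K0 K'0 nv0 nvL conn_trans[OF conn_trans[OF conn_trans[OF 1 2] 3] 4]])
qed

section \<open>Ascents of one component to both endpoints\<close>

definition ascends :: "(nat \<Rightarrow> 'a) \<Rightarrow> nat \<Rightarrow> 'a \<Rightarrow> real \<Rightarrow> bool" where
  "ascends p K x m \<longleftrightarrow> chain VA FA p K \<and> p K = x \<and> f (p 0) = m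
    \<and> (\<forall>i. 0 < i \<and> i \<le> K \<longrightarrow> m < f (p i)) \<and> (\<not> VA x \<and> 0 < K \<longrightarrow> f (p (K - 1)) < f x)"

text \<open>Cut \<open>u\<close> at its last index of level at most \<open>m\<close> and start on
  the next edge where the level equals \<open>m\<close>. The clause on \<open>p 0\<close> lets two
  ascents be recognised as starting at the same point.\<close>

lemma last_ascent:
  assumes u: "chain VA FA u K" "\<not> VA (u K) \<Longrightarrow> 0 < K \<Longrightarrow> f (u (K - 1)) < f (u K)"
    and k: "k \<le> K" "f (u k) \<le> m" "m \<le> f (u K)"
  obtains j p where "k \<le> j" "j \<le> K" "ascends p (K - j) (u K) m" "f (u j) = m \<Longrightarrow> p 0 = u j"
    "\<And>h. h \<le> K \<Longrightarrow> f (u h) \<le> m \<Longrightarrow> h \<le> j"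
proof -
  obtain j where j: "j \<le> K" "f (u j) \<le> m" and after: "\<And>h. j < h \<Longrightarrow> h \<le> K \<Longrightarrow> m < f (u h)"
    using ex_last_index[of "\<lambda>i. f (u i) \<le> m" k K] k by (auto simp: not_le)
  have jlast: "h \<le> j" if "h \<le> K" "f (u h) \<le> m" for h using after[of h] that by force
  note kj = jlast[OF k(1,2)]
  show thesis
  proof (cases "j = K")
    case True
    then have "ascends (\<lambda>_. u K) (K - j) (u K) m" using j k by (auto simp: ascends_def)
    then show thesis using that[OF kj j(1)] True jlast by auto
  next
    case False
    then have jK: "j < K" using j by simp
    obtain E where E: "FA E" "u j \<in> E" "u (Suc j) \<in> E" using chain_edge[OF u(1) jK] by blast
    obtain q where q: "q \<in> E" "f q = m" "f (u j) = m \<Longrightarrow> q = u j"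
    proof (cases "f (u j) = m")
      case True
      then show ?thesis using that E by blast
    next
      case False
      then show ?thesis using that betweenA[OF E, of m] j after[of "Suc j"] jK by fastforce
    qed
    let ?p = "(\<lambda>h. u (j + h))(0 := q)"
    have "ascends ?p (K - j) (u K) m"
      unfolding ascends_def
    proof (intro conjI)
      show "chain VA FA ?p (K - j)" using chain_start[OF chain_shift[OF u(1)] E(1) q(1)] E(3) by simp
      show "\<forall>i. 0 < i \<and> i \<le> K - j \<longrightarrow> m < f (?p i)" using after by auto
      show "\<not> VA (u K) \<and> 0 < K - j \<longrightarrow> f (?p (K - j - 1)) < f (u K)"
        using u(2) after[of K] jK q by auto
    qed (use jK q in auto)
    then show thesis using that[OF kj j(1)] q(3) jlast by auto
  qed
qed

text \<open>The last two alternatives of this definition arise if the edge through a non-vertex endpoint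
  is unbounded below.\<close>

definition two_ascents :: "'a \<Rightarrow> 'a \<Rightarrow> real \<Rightarrow> bool" where
  "two_ascents x x' m \<longleftrightarrow> (\<exists>p K p' K'. ascends p K x m \<and> ascends p' K' x' m \<and>
    (K + K' \<le> dA + of_bool (\<not> VA x) + of_bool (\<not> VA x')
        \<and> (K = 0 \<longrightarrow> K' \<le> dA + of_bool (\<not> VA x')) \<and> (K' = 0 \<longrightarrow> K \<le> dA + of_bool (\<not> VA x))
      \<or> p 0 = p' 0 \<and> \<not> VA x \<and> K \<le> 1 \<and> K' \<le> dA + 1 + of_bool (\<not> VA x')
      \<or> p 0 = p' 0 \<and> \<not> VA x' \<and> K' \<le> 1 \<and> K \<le> dA + 1 + of_bool (\<not> VA x)))"

lemma two_ascents_sym: "two_ascents x x' m \<Longrightarrow> two_ascents x' x m"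
  unfolding two_ascents_def
proof (elim exE conjE, goal_cases)
  case (1 p K p' K')
  then show ?case by (intro exI[of _ p'] exI[of _ K'] exI[of _ p] exI[of _ K]) auto
qed

text \<open>The walk dips to level \<open>m\<close> or below at \<open>k\<close>; the ascents to
  \<open>x'\<close> and, backwards, to \<open>x\<close> lie on opposite sides of \<open>k\<close>,
  so together they use at most \<open>K\<close> edges.\<close>

lemma two_ascents_chain:
  assumes u: "chain VA FA u K" "u 0 = x" "u K = x'"
      "\<not> VA x \<Longrightarrow> 0 < K \<and> f (u 1) < f x" "\<not> VA x' \<Longrightarrow> 0 < K \<and> f (u (K - 1)) < f x'"
      "K \<le> dA + of_bool (\<not> VA x) + of_bool (\<not> VA x')"
    and k: "k \<le> K" "f (u k) \<le> m" and m: "m \<le> f x" "m \<le> f x'"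
  shows "two_ascents x x' m"
proof -
  obtain j p' where j: "k \<le> j" "j \<le> K" "ascends p' (K - j) x' m"
    and jlast: "\<And>h. h \<le> K \<Longrightarrow> f (u h) \<le> m \<Longrightarrow> h \<le> j"
    using last_ascent[OF u(1) _ k] u m by metis
  let ?r = "\<lambda>i. u (K - i)"
  obtain i p where i: "K - k \<le> i" "i \<le> K" "ascends p (K - i) x m"
    and ilast: "\<And>h. h \<le> K \<Longrightarrow> f (?r h) \<le> m \<Longrightarrow> h \<le> i"
  proof (rule last_ascent[OF chain_rev[OF u(1)], of "K - k" m])
    show "f (?r (K - 1)) < f (?r K)" if "\<not> VA (?r K)" using u that by auto
  qed (use u k m that in auto)
  \<comment> \<open>An empty ascent means that \<open>x\<close> has level \<open>m\<close>. For a
    non-vertex \<open>x\<close> the point \<open>u 1\<close> is then below \<open>m\<close>, so the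
    other ascent loses the first edge.\<close>
  have "K - j \<le> dA + of_bool (\<not> VA x')" if "K - i = 0"
  proof (cases "VA x")
    case False
    have "f x = m" using i(3) that unfolding ascends_def by auto
    then show ?thesis using jlast[of 1] u(4,6) False by auto
  qed (use u(6) in auto)
  moreover have "K - i \<le> dA + of_bool (\<not> VA x)" if "K - j = 0"
  proof (cases "VA x'")
    case False
    have "f x' = m" using j(3) that unfolding ascends_def by auto
    then show ?thesis using ilast[of 1] u(5,6) False by auto
  qed (use u(6) in auto)
  moreover have "K - i + (K - j) \<le> dA + of_bool (\<not> VA x) + of_bool (\<not> VA x')"
    using i j k(1) u(6) by linarith
  ultimately show ?thesis using i(3) j(3) unfolding two_ascents_def by (intro exI conjI disjI1 impI)
qed

section \<open>Endpoints with and without a lower vertex on their edge\<close>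

definition low :: "'a \<Rightarrow> bool" where
  "low x \<longleftrightarrow> VA x \<or> (\<exists>E w. FA E \<and> x \<in> E \<and> w \<in> E \<and> VA w \<and> f w < f x)"

lemma low_base:
  assumes "low x"
  obtains w where "VA w" "VA x \<Longrightarrow> w = x" "\<not> VA x \<Longrightarrow> \<exists>E. FA E \<and> x \<in> E \<and> w \<in> E \<and> f w < f x"
  using assms unfolding low_def by blast

text \<open>An edge missing a level below \<open>x\<close> would end in a vertex not above
  \<open>x\<close>, hence strictly below it by injectivity of the level.\<close>

lemma not_low_ray:
  assumes "W x y" "\<not> low x"
  obtains E w where "FA E" "nonconst f E" "x \<in> E" "w \<in> E" "VA w" "\<forall>t\<le>f x. \<exists>p\<in>E. f p = t"
proof -
  have nv: "\<not> VA x" using assms unfolding low_def by simp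
  obtain E w where E: "FA E" "nonconst f E" "x \<in> E" "w \<in> E" "VA w" using W_nonvertexA[OF assms(1) nv] by blast
  have "\<exists>p\<in>E. f p = t" if t: "t \<le> f x" for t
  proof (rule ccontr)
    assume n: "\<not> (\<exists>p\<in>E. f p = t)"
    then have "t < f x" "t \<notin> f ` E" using E(3) t by force+
    then obtain v where v: "v \<in> E" "VA v" "f v \<le> f x" using botA[OF E(1-3)] E(3) by blast
    then have "f v \<noteq> f x" using injA[OF E(1,2) v(1) E(3)] nv by blast
    then show False using v assms(2) E unfolding low_def by force
  qed
  then show thesis using that E by blast
qed

lemma extend_chain_low:
  assumes "VA w" "low x"
  obtains u K where "chain VA FA u K" "u 0 = w" "u K = x" "K \<le> dA + of_bool (\<not> VA x)"
    "\<not> VA x \<Longrightarrow> 0 < K \<and> f (u (K - 1)) < f x"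
proof -
  obtain w' where w': "VA w'" "VA x \<Longrightarrow> w' = x" "\<not> VA x \<Longrightarrow> \<exists>E. FA E \<and> x \<in> E \<and> w' \<in> E \<and> f w' < f x"
    by (rule low_base[OF assms(2)]) (rule that, (assumption | blast)+)
  obtain n u where u: "n \<le> dA" "chain VA FA u n" "u 0 = w'" "u n = w" using pathA[OF w'(1) assms(1)] by blast
  show thesis
  proof (cases "VA x")
    case True
    then show thesis using that[OF chain_rev[OF u(2)]] u w' by simp
  next
    case False
    then obtain E where E: "FA E" "x \<in> E" "w' \<in> E" "f w' < f x" using w' by blast
    have "chain VA FA (case_nat x u) (Suc n)" using chain_Cons[OF u(2)] u(3) w'(1) E by auto
    from chain_rev[OF this] show thesis by (rule that) (use u E False in auto)
  qed
qed

text \<open>A walk between the lower vertices of \<open>x\<close> and \<open>x'\<close> is prolonged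
  by one edge at each non-vertex end, which is therefore reached from below.\<close>

lemma chain_low:
  assumes "low x" "low x'"
  obtains u K where "chain VA FA u K" "u 0 = x" "u K = x'" "K \<le> dA + of_bool (\<not> VA x) + of_bool (\<not> VA x')"
    "\<not> VA x \<Longrightarrow> 0 < K \<and> f (u 1) < f x" "\<not> VA x' \<Longrightarrow> 0 < K \<and> f (u (K - 1)) < f x'"
proof -
  obtain w where w: "VA w" "VA x \<Longrightarrow> w = x" "\<not> VA x \<Longrightarrow> \<exists>E. FA E \<and> x \<in> E \<and> w \<in> E \<and> f w < f x"
    by (rule low_base[OF assms(1)]) (rule that, (assumption | blast)+)
  obtain u K where u: "chain VA FA u K" "u 0 = w" "u K = x'" "K \<le> dA + of_bool (\<not> VA x')"
    "\<not> VA x' \<Longrightarrow> 0 < K \<and> f (u (K - 1)) < f x'" by (rule extend_chain_low[OF w(1) assms(2)]) (rule that, (assumption | blast)+)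
  show thesis
  proof (cases "VA x")
    case True
    then show thesis using that[OF u(1)] u w by simp
  next
    case False
    then obtain E where E: "FA E" "x \<in> E" "w \<in> E" "f w < f x" using w by blast
    have "chain VA FA (case_nat x u) (Suc K)" using chain_Cons[OF u(1)] u(2) w(1) E by auto
    then show thesis by (rule that) (use u E False in \<open>auto split: nat.split\<close>)
  qed
qed

text \<open>The edge through \<open>x\<close> reaches level \<open>m\<close> at \<open>q\<close>, so
  \<open>x\<close> has an ascent of at most one edge. The ascent to \<open>x'\<close> uses its own
  unbounded edge or a walk from \<open>q\<close> through a vertex \<open>w\<close> of the edge of
  \<open>x\<close>.\<close>

lemma two_ascents_ray:
  assumes W: "W x y" "W x' y'" and m: "m \<le> f x" "m \<le> f x'" and nlow: "\<not> low x"
  shows "two_ascents x x' m"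
proof -
  have nv: "\<not> VA x" using nlow unfolding low_def by simp
  have short: "ascends (case_nat p (\<lambda>_. z)) (if f z = m then 0 else 1) z m"
    if "FA E" "z \<in> E" "p \<in> E" "f p = m" "m \<le> f z" "f z = m \<Longrightarrow> p = z" for E z p
    unfolding ascends_def chain_def using that by (auto split: nat.splits)
  obtain E w where E: "FA E" "nonconst f E" "x \<in> E" "w \<in> E" "VA w" "\<forall>t\<le>f x. \<exists>p\<in>E. f p = t"
    by (rule not_low_ray[OF W(1) nlow])
  obtain q where q: "q \<in> E" "f q = m" using E(6) m by blast
  define K :: nat where "K = (if f x = m then 0 else 1)"
  have asc: "ascends (case_nat q (\<lambda>_. x)) K x m"
    unfolding K_def by (rule short[OF E(1,3) q m(1)]) (use injA[OF E(1,2) q(1) E(3)] q in auto)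
  have K1: "K \<le> 1" unfolding K_def by simp
  show ?thesis
  proof (cases "low x'")
    case False
    have nv': "\<not> VA x'" using False unfolding low_def by simp
    obtain E' w' where E': "FA E'" "nonconst f E'" "x' \<in> E'" "w' \<in> E'" "VA w'"
      "\<forall>t\<le>f x'. \<exists>p\<in>E'. f p = t"
      by (rule not_low_ray[OF W(2) False])
    obtain q' where q': "q' \<in> E'" "f q' = m" using E'(6) m by blast
    have asc': "ascends (case_nat q' (\<lambda>_. x')) (if f x' = m then 0 else 1) x' m"
      by (rule short[OF E'(1,3) q' m(2)]) (use injA[OF E'(1,2) q'(1) E'(3)] q' in auto)
    show ?thesis unfolding two_ascents_def
      using asc asc' K1 nv nv' by (intro exI conjI disjI1) auto
  next
    case True
    obtain u n where u: "chain VA FA u n" "u 0 = w" "u n = x'" "n \<le> dA + of_bool (\<not> VA x')"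
      "\<not> VA x' \<Longrightarrow> 0 < n \<and> f (u (n - 1)) < f x'" by (rule extend_chain_low[OF E(5) True]) (rule that, (assumption | blast)+)
    let ?u = "case_nat q u"
    have "chain VA FA ?u (Suc n)" using chain_Cons[OF u(1)] u(2) E q by auto
    then obtain j p where j: "j \<le> Suc n" "ascends p (Suc n - j) (?u (Suc n)) m" "f (?u j) = m \<Longrightarrow> p 0 = ?u j"
    proof (rule last_ascent[of ?u "Suc n" 0 m])
      show "f (?u (Suc n - 1)) < f (?u (Suc n))" if "\<not> VA (?u (Suc n))"
        using u that by (auto split: nat.split)
    qed (use u q m in auto)
    have j2: "ascends p (Suc n - j) x' m" using j(2) u by simp
    show ?thesis
    \<comment> \<open>For \<open>j = 0\<close> both ascents start at \<open>q\<close>, which saves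
      the gluing jump; for \<open>j > 0\<close> the edge from \<open>q\<close> to \<open>w\<close>
      is dropped.\<close>
    proof (cases "j = 0")
      case True
      then have "p 0 = q" using j(3) q by simp
      then show ?thesis unfolding two_ascents_def
        using asc j2 K1 nv True u(4)
        by (intro exI[of _ "case_nat q (\<lambda>_. x)"] exI[of _ K] exI[of _ p] exI[of _ "Suc n"]) auto
    next
      case False
      then show ?thesis unfolding two_ascents_def
        using asc j2 K1 nv u(4) by (intro exI conjI disjI1) auto
    qed
  qed
qed

text \<open>Each nonempty climb in \<open>valley\<close> saves one edge. This pays for a non-vertex
  endpoint, since at most one component of a vertex of \<open>R\<close> is not a vertex.\<close>

lemma conn_two_ascents:
  assumes v: "chain VB FB v L" "v 0 = y" "v L = y'" "\<And>i. i \<le> L \<Longrightarrow> m \<le> g (v i)" "k \<le> L" "g (v k) = m"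
      "\<not> VB y \<Longrightarrow> 0 < L \<and> g (v 1) < g y" "\<not> VB y' \<Longrightarrow> 0 < L \<and> g (v (L - 1)) < g y'"
      "L \<le> dB + of_bool (\<not> VB y) + of_bool (\<not> VB y')"
    and W: "W x y" "W x' y'" and asc: "two_ascents x x' m"
  shows "conn x y x' y' (dA * (DA + 1) + dB * (DB + 1) + 1)"
proof -
  define ex ex' ey ey' :: nat where e_defs: "ex = of_bool (\<not> VA x)" "ex' = of_bool (\<not> VA x')"
    "ey = of_bool (\<not> VB y)" "ey' = of_bool (\<not> VB y')"
  have e: "ex + ey \<le> 1" "ex' + ey' \<le> 1" using W_cases[OF W(1)] W_cases[OF W(2)] unfolding e_defs by auto
  obtain p K p' K' where p: "ascends p K x m" and p': "ascends p' K' x' m" and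
    KK: "K + K' \<le> dA + ex + ex' \<and> (K = 0 \<longrightarrow> K' \<le> dA + ex') \<and> (K' = 0 \<longrightarrow> K \<le> dA + ex)
      \<or> p 0 = p' 0 \<and> ex = 1 \<and> K \<le> 1 \<and> K' \<le> dA + 1 + ex'
      \<or> p 0 = p' 0 \<and> ex' = 1 \<and> K' \<le> 1 \<and> K \<le> dA + 1 + ex"
    using asc unfolding two_ascents_def e_defs of_bool_eq_1_iff by blast
  have ends: "p K = x" "p' K' = x'" using p p' unfolding ascends_def by auto
  obtain i j where ij: "i \<le> j" "j \<le> L" "K = 0 \<longleftrightarrow> i = 0" "K' = 0 \<longleftrightarrow> j = L"
    "\<not> VB (v 0) \<Longrightarrow> 0 < i" "\<not> VB (v L) \<Longrightarrow> j < L"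
    "conn (p K) (v 0) (p' K') (v L) (climb_cost (p K) K (v 0) i + (if p 0 = p' 0 then 0 else DA)
      + (j - i + (if i = j then 0 else DB)) + climb_cost (p' K') K' (v L) (L - j))"
    by (rule valley[of p K m p' K' v L k]) (use p p' v W in \<open>auto simp: ascends_def\<close>)
  have ey: "ey \<le> i" "ey' \<le> L - j" using ij(5,6) v(2,3) unfolding e_defs by auto
  have L: "L \<le> dB + ey + ey'" using v(9) unfolding e_defs .
  define edges jA jB where "edges = (K + i - 1) + (j - i) + (K' + (L - j) - 1)"
    and "jA = (K - 1 - ex) + of_bool (p 0 \<noteq> p' 0) + (K' - 1 - ex')"
    and "jB = (i - 1 - ey) + of_bool (i \<noteq> j) + (L - j - 1 - ey')"
  have "conn x y x' y' (edges + jA * DA + jB * DB)"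
    by (rule conn_mono[OF ij(7)[unfolded ends v(2,3)]])
      (simp add: climb_cost_def edges_def jA_def jB_def e_defs algebra_simps)
  moreover have "edges + jA * DA + jB * DB \<le> dA * (DA + 1) + dB * (DB + 1) + 1"
  proof -
    have "jB \<le> dB" unfolding jB_def using ij(1,2) ey L by (cases "i = j") auto
    then have jB: "jB * DB \<le> dB * DB" by (rule mult_right_mono) simp
    have "edges + jA * DA \<le> dA + dB + 1 + dA * DA"
      using KK
    proof (elim disjE conjE)
      assume A: "K + K' \<le> dA + ex + ex'" "K = 0 \<longrightarrow> K' \<le> dA + ex'" "K' = 0 \<longrightarrow> K \<le> dA + ex"
      \<comment> \<open>An empty climb saves no edge; the clauses for \<open>K = 0\<close> and
        \<open>K' = 0\<close> make up for it.\<close>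
      have "edges \<le> dA + dB" unfolding edges_def
        using A ij(1-4) ey L e by (cases "K = 0"; cases "K' = 0") auto
      \<comment> \<open>For \<open>dA = 0\<close> the gluing jump may remain; then
        \<open>DA \<le> 1\<close>, and the spare 1 of the bound pays for it.\<close>
      moreover have "jA \<le> max dA 1" unfolding jA_def
        using A e by (cases "K = 0"; cases "K' = 0") auto
      then have "jA * DA \<le> max dA 1 * DA" by (rule mult_right_mono) simp
      moreover have "max dA 1 * DA \<le> dA * DA + 1" 
        using dA_0 by (cases "dA = 0") (auto simp: max_absorb1)
      ultimately show ?thesis by linarith
    next
      \<comment> \<open>No gluing jump occurs here, so the spare 1 can be spent on an additional
        edge.\<close>
      assume A: "p 0 = p' 0" "ex = 1" "K \<le> 1" "K' \<le> dA + 1 + ex'"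
      have "edges \<le> dA + dB + 1" unfolding edges_def
        using A ij(1-4) ey L e by (cases "K = 0"; cases "K' = 0") auto
      moreover have "jA \<le> dA" unfolding jA_def using A by auto
      then have "jA * DA \<le> dA * DA" by (rule mult_right_mono) simp
      ultimately show ?thesis by linarith
    next
      assume A: "p 0 = p' 0" "ex' = 1" "K' \<le> 1" "K \<le> dA + 1 + ex"
      have "edges \<le> dA + dB + 1" unfolding edges_def
        using A ij(1-4) ey L e by (cases "K = 0"; cases "K' = 0") auto
      moreover have "jA \<le> dA" unfolding jA_def using A by auto
      then have "jA * DA \<le> dA * DA" by (rule mult_right_mono) simp
      ultimately show ?thesis by linarith
    qed
    then show ?thesis using jB unfolding distrib_left by linarith
  qed
  ultimately show ?thesis by (rule conn_mono)
qed

section \<open>The distance between arbitrary vertices\<close>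

definition lowB :: "'b \<Rightarrow> bool" where
  "lowB y \<longleftrightarrow> VB y \<or> (\<exists>G w. FB G \<and> y \<in> G \<and> w \<in> G \<and> VB w \<and> g w < g y)"

lemma low_swap: "climbing.low VB FB g = lowB" "climbing.lowB VA FA f = low"
proof -
  interpret sw: climbing VB FB g dB DB VA FA f dA DA "\<lambda>y x. W x y" "\<lambda>y x y' x'. conn x y x' y'"
    by (rule climbing_swap)
  show "climbing.low VB FB g = lowB" "climbing.lowB VA FA f = low"
    by (auto simp: low_def lowB_def sw.low_def sw.lowB_def fun_eq_iff)
qed

lemma chain_lowB:
  assumes "lowB y" "lowB y'"
  obtains u K where "chain VB FB u K" "u 0 = y" "u K = y'" "K \<le> dB + of_bool (\<not> VB y) + of_bool (\<not> VB y')"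
    "\<not> VB y \<Longrightarrow> 0 < K \<and> g (u 1) < g y" "\<not> VB y' \<Longrightarrow> 0 < K \<and> g (u (K - 1)) < g y'"
  using climbing.chain_low[OF climbing_swap, unfolded low_swap, OF assms] by metis

lemma ex_lowest: "\<exists>k\<le>n. \<forall>i\<le>n. h (u k) \<le> h (u i)" for h :: "'c \<Rightarrow> real" and n :: nat
proof -
  have "Min ((\<lambda>i. h (u i)) ` {..n}) \<in> (\<lambda>i. h (u i)) ` {..n}" by (rule Min_in) auto
  then obtain k where "k \<le> n" "h (u k) = Min ((\<lambda>i. h (u i)) ` {..n})" by (auto simp del: Min_in)
  then show ?thesis by auto
qed

text \<open>The valley level is the lowest level of the walk in the second factor; an unbounded edge
  in the first factor reaches down to it.\<close>

lemma conn_ray: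
  assumes W: "W x y" "W x' y'" and "lowB y" "lowB y'" "\<not> low x \<or> \<not> low x'"
  shows "conn x y x' y' (dA * (DA + 1) + dB * (DB + 1) + 1)"
proof -
  obtain v L where v: "chain VB FB v L" "v 0 = y" "v L = y'"
      "L \<le> dB + of_bool (\<not> VB y) + of_bool (\<not> VB y')"
      "\<not> VB y \<Longrightarrow> 0 < L \<and> g (v 1) < g y" "\<not> VB y' \<Longrightarrow> 0 < L \<and> g (v (L - 1)) < g y'"
    by (rule chain_lowB[OF assms(3,4)]) (rule that, (assumption | blast)+)
  obtain k where k: "k \<le> L" "\<And>i. i \<le> L \<Longrightarrow> g (v k) \<le> g (v i)" using ex_lowest[of L g v] by blast
  have m: "g (v k) \<le> f x" "g (v k) \<le> f x'" using k(2)[of 0] k(2)[of L] W W_level v by auto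
  have "two_ascents x x' (g (v k))"
    using two_ascents_ray[OF W m] two_ascents_sym[OF two_ascents_ray[OF W(2,1) m(2,1)]] assms(5) by blast
  then show ?thesis using conn_two_ascents[OF v(1-3) k(2,1) refl v(5,6,4) W] by blast
qed

text \<open>The valley level is the higher of the two lowest levels: it is the minimum of one walk,
  and the other walk still reaches it.\<close>

lemma conn_low:
  assumes W: "W x y" "W x' y'" and "low x" "low x'" "lowB y" "lowB y'"
  shows "conn x y x' y' (dA * (DA + 1) + dB * (DB + 1) + 1)"
proof -
  obtain u K where u: "chain VA FA u K" "u 0 = x" "u K = x'"
      "K \<le> dA + of_bool (\<not> VA x) + of_bool (\<not> VA x')"
      "\<not> VA x \<Longrightarrow> 0 < K \<and> f (u 1) < f x" "\<not> VA x' \<Longrightarrow> 0 < K \<and> f (u (K - 1)) < f x'"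
    by (rule chain_low[OF assms(3,4)]) (rule that, (assumption | blast)+)
  obtain v L where v: "chain VB FB v L" "v 0 = y" "v L = y'"
      "L \<le> dB + of_bool (\<not> VB y) + of_bool (\<not> VB y')"
      "\<not> VB y \<Longrightarrow> 0 < L \<and> g (v 1) < g y" "\<not> VB y' \<Longrightarrow> 0 < L \<and> g (v (L - 1)) < g y'"
    by (rule chain_lowB[OF assms(5,6)]) (rule that, (assumption | blast)+)
  obtain k where k: "k \<le> K" "\<And>i. i \<le> K \<Longrightarrow> f (u k) \<le> f (u i)" using ex_lowest[of K f u] by blast
  obtain l where l: "l \<le> L" "\<And>i. i \<le> L \<Longrightarrow> g (v l) \<le> g (v i)" using ex_lowest[of L g v] by blast
  have ml: "g (v l) \<le> f x" "g (v l) \<le> f x'" using l(2)[of 0] l(2)[of L] W W_level v by auto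
  have mk: "f (u k) \<le> g y" "f (u k) \<le> g y'" using k(2)[of 0] k(2)[of K] W W_level u by force+
  show ?thesis
  proof (cases "f (u k) \<le> g (v l)")
    case True
    have "two_ascents x x' (g (v l))" by (rule two_ascents_chain[OF u(1-3,5,6,4) k(1) True ml])
    then show ?thesis using conn_two_ascents[OF v(1-3) l(2,1) refl v(5,6,4) W] by blast
  next
    case False
    then have le: "g (v l) \<le> f (u k)" by simp
    interpret sw: climbing VB FB g dB DB VA FA f dA DA "\<lambda>y x. W x y" "\<lambda>y x y' x'. conn x y x' y'"
      by (rule climbing_swap)
    have "sw.two_ascents y y' (f (u k))"
      by (rule sw.two_ascents_chain[OF v(1-3,5,6,4) l(1) le mk])
    then have "conn x y x' y' (dB * (DB + 1) + dA * (DA + 1) + 1)"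
      using sw.conn_two_ascents[OF u(1-3) k(2,1) refl u(5,6,4) W] by blast
    then show ?thesis by (simp add: add.commute add.left_commute)
  qed
qed

theorem conn_bound:
  assumes W: "W x y" "W x' y'"
  shows "conn x y x' y' (dA * (DA + 1) + dB * (DB + 1) + 1)"
proof -
  interpret sw: climbing VB FB g dB DB VA FA f dA DA "\<lambda>y x. W x y" "\<lambda>y x y' x'. conn x y x' y'"
    by (rule climbing_swap)
  interpret fl: climbing VA FA "\<lambda>x. - f x" dA DA VB FB "\<lambda>y. - g y" dB DB W conn
    by (rule climbing_flip)
  have oneside: "lowB y \<or> low x" if "W x y" for x y
    using W_cases[OF that] unfolding low_def lowB_def by blast
  have flA: "fl.low x" if W': "W x y" and nl: "VA x \<or> \<not> low x" for x y
  proof (cases "VA x")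
    case False
    then obtain E w where E: "FA E" "nonconst f E" "x \<in> E" "w \<in> E" "VA w"
      using W_nonvertexA[OF W'] by blast
    then have "f w \<noteq> f x" using injA[OF E(1,2,4,3)] False by blast
    then show ?thesis using E nl False unfolding low_def fl.low_def by force
  qed (simp add: fl.low_def)
  have flB: "fl.lowB y" if W': "W x y" and nl: "VB y \<or> \<not> lowB y" for x y
  proof (cases "VB y")
    case False
    then obtain E w where E: "FB E" "nonconst g E" "y \<in> E" "w \<in> E" "VB w"
      using W_nonvertexB[OF W'] by blast
    then have "g w \<noteq> g y" using injB[OF E(1,2,4,3)] False by blast
    then show ?thesis using E nl False unfolding lowB_def fl.lowB_def by force
  qed (simp add: fl.lowB_def)
  consider "low x" "low x'" "lowB y" "lowB y'"
    | "\<not> low x \<or> \<not> low x'" "lowB y" "lowB y'"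
    | "\<not> lowB y \<or> \<not> lowB y'" "low x" "low x'"
    | "\<not> low x \<and> \<not> lowB y' \<or> \<not> low x' \<and> \<not> lowB y"
    using oneside[OF W(1)] oneside[OF W(2)] by blast
  then show ?thesis
  proof cases
    case 1
    then show ?thesis using conn_low[OF W] by blast
  next
    case 2
    then show ?thesis using conn_ray[OF W] by blast
  next
    case 3
    then have "conn x y x' y' (dB * (DB + 1) + dA * (DA + 1) + 1)"
      using sw.conn_ray[OF W] unfolding low_swap by blast
    then show ?thesis by (simp add: add.commute add.left_commute)
  next
    case 4
    \<comment> \<open>One edge in each factor is unbounded below, at opposite endpoints. After
      negation a vertex on such an edge lies below its endpoint, and the other two components are
      vertices, so all four become low.\<close>
    have v: "VB y" if "\<not> low x" using that W_cases[OF W(1)] unfolding low_def by blast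
    have v': "VB y'" if "\<not> low x'" using that W_cases[OF W(2)] unfolding low_def by blast
    have w: "VA x" if "\<not> lowB y" using that W_cases[OF W(1)] unfolding lowB_def by blast
    have w': "VA x'" if "\<not> lowB y'" using that W_cases[OF W(2)] unfolding lowB_def by blast
    have "fl.low x" "fl.low x'" "fl.lowB y" "fl.lowB y'"
      using 4 flA[OF W(1)] flA[OF W(2)] flB[OF W(1)] flB[OF W(2)] v v' w w' by blast+
    then show ?thesis using fl.conn_low[OF W] by blast
  qed
qed

end

section \<open>Edge walks and collinear faces\<close>

text \<open>Powers of the adjacency relation avoid infima in \<open>enat\<close>;
  \<open>poly_dist_le_iff\<close> gives the link to \<open>poly_dist\<close>.\<close>

definition near :: "'a::real_vector set \<Rightarrow> nat \<Rightarrow> 'a \<Rightarrow> 'a \<Rightarrow> bool" where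
  "near P n v w \<longleftrightarrow> (\<exists>k\<le>n. (v, w) \<in> {(v, w). vertex_adj P v w} ^^ k)"

lemma near_refl: "near P 0 v v"
  unfolding near_def by auto

lemma near_mono: "near P m v w \<Longrightarrow> m \<le> n \<Longrightarrow> near P n v w"
  unfolding near_def by (meson order_trans)

lemma near_trans: "near P m u v \<Longrightarrow> near P n v w \<Longrightarrow> near P (m + n) u w"
  unfolding near_def
proof (elim exE conjE)
  fix k l assume "k \<le> m" "l \<le> n" "(u, v) \<in> {(v, w). vertex_adj P v w} ^^ k" "(v, w) \<in> {(v, w). vertex_adj P v w} ^^ l"
  then show "\<exists>k\<le>m + n. (u, w) \<in> {(v, w). vertex_adj P v w} ^^ k"
    by (intro exI[of _ "k + l"]) (auto simp: relpow_add)
qed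

lemma vertex_adj_sym: "vertex_adj P v w \<Longrightarrow> vertex_adj P w v"
  unfolding vertex_adj_def by (metis closed_segment_commute)

lemma near_sym:
  assumes "near P n v w" shows "near P n w v"
proof -
  obtain k h where k: "k \<le> n" "h 0 = v" "h k = w" "\<forall>i<k. vertex_adj P (h i) (h (Suc i))"
    using assms unfolding near_def relpow_fun_conv by auto
  have "vertex_adj P (h (k - i)) (h (k - Suc i))" if "i < k" for i
    using k(4)[rule_format, of "k - Suc i"] that vertex_adj_sym by (metis Suc_diff_Suc diff_Suc_less less_nat_zero_code neq0_conv)
  then show ?thesis unfolding near_def relpow_fun_conv
    using k by (intro exI[of _ k] conjI exI[of _ "\<lambda>i. h (k - i)"]) auto
qed

lemma near_adj: "vertex_adj P v w \<Longrightarrow> near P 1 v w"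
  unfolding near_def by (intro exI[of _ 1]) auto

lemma near_map:
  assumes "near S n v w" "\<And>v w. vertex_adj S v w \<Longrightarrow> vertex_adj R (\<phi> v) (\<phi> w)"
  shows "near R n (\<phi> v) (\<phi> w)"
proof -
  obtain k h where k: "k \<le> n" "h 0 = v" "h k = w" "\<forall>i<k. (h i, h (Suc i)) \<in> {(v, w). vertex_adj S v w}"
    using assms(1) unfolding near_def relpow_fun_conv by blast
  then show ?thesis unfolding near_def relpow_fun_conv
    using assms(2) by (intro exI[of _ k] conjI exI[of _ "\<lambda>i. \<phi> (h i)"]) auto
qed

lemma edge_walk_relpow:
  "(\<exists>xs. edge_walk P xs \<and> hd xs = v \<and> last xs = w \<and> length xs - 1 = k)
    \<longleftrightarrow> (v, w) \<in> {(v, w). vertex_adj P v w} ^^ k"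
proof
  assume "\<exists>xs. edge_walk P xs \<and> hd xs = v \<and> last xs = w \<and> length xs - 1 = k"
  then obtain xs where xs: "edge_walk P xs" "hd xs = v" "last xs = w" "length xs - 1 = k" by blast
  then show "(v, w) \<in> {(v, w). vertex_adj P v w} ^^ k" unfolding relpow_fun_conv edge_walk_def
    by (intro exI[of _ "(!) xs"]) (auto simp: hd_conv_nth last_conv_nth)
next
  assume "(v, w) \<in> {(v, w). vertex_adj P v w} ^^ k"
  then obtain h where "h 0 = v" "h k = w" "\<forall>i<k. vertex_adj P (h i) (h (Suc i))"
    unfolding relpow_fun_conv by auto
  then show "\<exists>xs. edge_walk P xs \<and> hd xs = v \<and> last xs = w \<and> length xs - 1 = k"
    by (intro exI[of _ "map h [0..<Suc k]"])
      (auto simp: edge_walk_def hd_conv_nth last_conv_nth nth_map_upt simp del: upt_Suc)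
qed

lemma poly_dist_le_iff: "poly_dist P v w \<le> enat n \<longleftrightarrow> near P n v w"
proof
  assume "poly_dist P v w \<le> enat n"
  also have "enat n < enat (Suc n)" by simp
  finally obtain xs where "edge_walk P xs" "hd xs = v" "last xs = w" "length xs - 1 < Suc n"
    unfolding poly_dist_def INF_less_iff by auto
  then show "near P n v w" unfolding near_def edge_walk_relpow[symmetric]
    by (intro exI[of _ "length xs - 1"]) auto
next
  assume "near P n v w"
  then obtain xs where xs: "edge_walk P xs" "hd xs = v" "last xs = w" "length xs - 1 \<le> n"
    unfolding near_def edge_walk_relpow[symmetric] by blast
  then have "poly_dist P v w \<le> enat (length xs - 1)"
    unfolding poly_dist_def by (intro INF_lower) auto
  also have "\<dots> \<le> enat n" using xs by simp
  finally show "poly_dist P v w \<le> enat n" .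
qed

lemma mat_diam_near:
  assumes "mat_diam M = enat d" "v extreme_point_of std_poly M r" "w extreme_point_of std_poly M r"
  shows "near (std_poly M r) d v w"
proof -
  have "poly_dist (std_poly M r) v w \<le> poly_diam (std_poly M r)"
    unfolding poly_diam_def using assms by (intro SUP_upper2[of "(v, w)"]) auto
  also have "\<dots> \<le> mat_diam M" unfolding mat_diam_def by (rule SUP_upper) simp
  finally show ?thesis using assms(1) poly_dist_le_iff by metis
qed

lemma near_chain:
  assumes "near P d v w" "v extreme_point_of P" "w extreme_point_of P"
  shows "\<exists>n\<le>d. \<exists>u. chain (\<lambda>x. x extreme_point_of P) (\<lambda>E. E face_of P \<and> collinear E) u n \<and> u 0 = v \<and> u n = w"
proof -
  obtain n u where u: "n \<le> d" "u 0 = v" "u n = w" "\<forall>i<n. vertex_adj P (u i) (u (Suc i))"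
    using assms(1) unfolding near_def relpow_fun_conv by auto
  have "chain (\<lambda>x. x extreme_point_of P) (\<lambda>E. E face_of P \<and> collinear E) u n"
    unfolding chain_def
  proof (intro conjI allI impI)
    fix i assume "i < n"
    then have "closed_segment (u i) (u (Suc i)) face_of P" using u unfolding vertex_adj_def by blast
    then show "\<exists>E. (E face_of P \<and> collinear E) \<and> u i \<in> E \<and> u (Suc i) \<in> E"
      by (intro exI[of _ "closed_segment (u i) (u (Suc i))"]) (auto simp: collinear_closed_segment)
  next
    fix i assume "0 < i \<and> i < n"
    then show "u i extreme_point_of P" using u unfolding vertex_adj_def by blast
  qed
  then show ?thesis using u by blast
qed

text \<open>A point of \<open>T\<close> outside the segment would put \<open>p\<close> or
  \<open>q\<close> strictly between two points of \<open>T\<close>, so \<open>T\<close> is the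
  segment.\<close>

lemma vertex_adj_collinear_face:
  fixes p q :: "'a::euclidean_space"
  assumes "T face_of S" "collinear T" "p \<in> T" "q \<in> T" "p extreme_point_of S" "q extreme_point_of S" "p \<noteq> q"
  shows "vertex_adj S p q"
proof -
  have ext: "p extreme_point_of T" "q extreme_point_of T" using assms extreme_point_of_face by blast+
  have "T = closed_segment p q"
  proof
    show "closed_segment p q \<subseteq> T"
      using assms face_of_imp_convex closed_segment_subset by blast
    show "T \<subseteq> closed_segment p q"
    proof
      fix z assume z: "z \<in> T"
      have "collinear {p, q, z}" using collinear_subset[OF assms(2)] assms z by auto
      then have "between (p, q) z \<or> between (q, z) p \<or> between (z, p) q"
        using collinear_between_cases by blast
      then show "z \<in> closed_segment p q"
        using ext z assms(3,4,7) unfolding between_mem_segment extreme_point_of_def open_segment_def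
        by auto
    qed
  qed
  then show ?thesis using assms unfolding vertex_adj_def by blast
qed

locale affine_functional =
  fixes k :: real and a :: "'a::euclidean_space" and h :: "'a \<Rightarrow> real"
  assumes h: "\<And>x. h x = k + a \<bullet> x"
begin

lemma collinear_inj:
  assumes "collinear E" "nonconst h E" "p \<in> E" "q \<in> E" "h p = h q"
  shows "p = q"
proof (rule ccontr)
  assume "p \<noteq> q"
  obtain u where u: "\<And>x y. x \<in> E \<Longrightarrow> y \<in> E \<Longrightarrow> \<exists>c. x - y = c *\<^sub>R u"
    using assms(1) unfolding collinear_def by blast
  obtain c where c: "p - q = c *\<^sub>R u" using u assms by blast
  have "c \<noteq> 0" using c \<open>p \<noteq> q\<close> by auto
  moreover have "a \<bullet> (p - q) = 0" using assms(5) h by (simp add: inner_diff_right)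
  ultimately have au: "a \<bullet> u = 0" using c by simp
  have "h x = h y" if xy: "x \<in> E" "y \<in> E" for x y
  proof -
    obtain c where "x - y = c *\<^sub>R u" using u xy by blast
    then have "a \<bullet> (x - y) = 0" using au by simp
    then show ?thesis using h by (simp add: inner_diff_right)
  qed
  then show False using assms(2) unfolding nonconst_def by blast
qed

lemma continuous_h: "continuous_on S h"
  unfolding h by (intro continuous_intros)

lemma convex_between:
  assumes "convex E" "p \<in> E" "q \<in> E" "h p \<le> t" "t \<le> h q"
  shows "\<exists>r\<in>E. h r = t"
proof -
  have "connected (h ` E)" using assms(1) continuous_h convex_connected connected_continuous_image by blast
  then show ?thesis using assms(2-5) connectedD_interval[of "h ` E" "h p" "h q" t] by auto
qed

text \<open>Missing \<open>t\<close> bounds \<open>h\<close> from above, so on a line with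
  nonconstant \<open>h\<close> the part of \<open>E\<close> above \<open>h p\<close> is compact. The
  maximum is attained, and only once as \<open>h\<close> is injective, so the maximiser is
  extreme.\<close>

lemma convex_top:
  assumes E: "convex E" "closed E" "collinear E" "nonconst h E" and p: "p \<in> E" "h p < t" and t: "t \<notin> h ` E"
  shows "\<exists>v\<in>E. v extreme_point_of E \<and> h v < t \<and> (\<forall>r\<in>E. h r \<le> h v)"
proof -
  have below: "h r < t" if "r \<in> E" for r
    using convex_between[OF E(1) p(1) that, of t] p t by force
  obtain u where u: "\<And>x y. x \<in> E \<Longrightarrow> y \<in> E \<Longrightarrow> \<exists>c. x - y = c *\<^sub>R u"
    using E(3) unfolding collinear_def by blast
  obtain p1 p2 where p12: "p1 \<in> E" "p2 \<in> E" "h p1 \<noteq> h p2" using E(4) unfolding nonconst_def by blast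
  have au: "a \<bullet> u \<noteq> 0"
  proof
    assume "a \<bullet> u = 0"
    moreover obtain c where "p1 - p2 = c *\<^sub>R u" using u p12 by blast
    ultimately have "a \<bullet> (p1 - p2) = 0" by simp
    then show False using p12 h by (simp add: inner_diff_right)
  qed
  define C where "C = E \<inter> {x. h p \<le> h x}"
  have "{x. h p \<le> h x} = {x. a \<bullet> p \<le> a \<bullet> x}" unfolding h by simp
  then have "closed C" unfolding C_def using E(2) closed_halfspace_ge[of "a \<bullet> p" a]
    by (simp add: closed_Int)
  moreover have "norm (x - p) \<le> (t - h p) / \<bar>a \<bullet> u\<bar> * norm u" if x: "x \<in> C" for x
  proof -
    obtain c where c: "x - p = c *\<^sub>R u" using u x p unfolding C_def by blast
    have "h x - h p = a \<bullet> (x - p)" using h by (simp add: inner_diff_right)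
    then have "\<bar>c\<bar> * \<bar>a \<bullet> u\<bar> = h x - h p" using c x unfolding C_def by (auto simp: abs_mult[symmetric])
    also have "\<dots> \<le> t - h p" using below x unfolding C_def by force
    finally have "\<bar>c\<bar> \<le> (t - h p) / \<bar>a \<bullet> u\<bar>" using au by (simp add: field_simps)
    then have "\<bar>c\<bar> * norm u \<le> (t - h p) / \<bar>a \<bullet> u\<bar> * norm u" by (rule mult_right_mono) simp
    then show ?thesis using c by simp
  qed
  then have "bounded C" unfolding bounded_def by (metis dist_norm norm_minus_commute)
  ultimately have "compact C" by (simp add: compact_eq_bounded_closed)
  moreover have "p \<in> C" using p unfolding C_def by simp
  ultimately obtain v where v: "v \<in> C" "\<And>x. x \<in> C \<Longrightarrow> h x \<le> h v"
    using continuous_attains_sup[of C h] continuous_h by blast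
  have vE: "v \<in> E" using v unfolding C_def by simp
  have vmax: "h r \<le> h v" if "r \<in> E" for r
    using v(2)[of r] v(2)[of p] \<open>p \<in> C\<close> that unfolding C_def by force
  have "v extreme_point_of E" unfolding extreme_point_of_def
  proof (intro conjI ballI notI vE)
    fix b c assume bc: "b \<in> E" "c \<in> E" "v \<in> open_segment b c"
    then obtain s where s: "0 < s" "s < 1" "v = (1 - s) *\<^sub>R b + s *\<^sub>R c" "b \<noteq> c"
      unfolding in_segment by auto
    have "h v = (1 - s) * h b + s * h c" unfolding s h by (simp add: algebra_simps inner_add_right)
    moreover have "(1 - s) * h b \<le> (1 - s) * h v" "s * h c \<le> s * h v"
      using vmax bc s by (auto intro: mult_left_mono)
    ultimately have "(1 - s) * h b = (1 - s) * h v" "s * h c = s * h v" by (auto simp: algebra_simps)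
    then have "h b = h c" using s by simp
    then show False using collinear_inj[OF E(3,4) bc(1,2)] s by blast
  qed
  then show ?thesis using vE vmax below by blast
qed

lemma face_top:
  assumes P: "convex P" "closed P" and E: "E face_of P" "collinear E" "nonconst h E"
    and p: "p \<in> E" "h p < t" "t \<notin> h ` E"
  shows "\<exists>v\<in>E. v extreme_point_of P \<and> h v < t \<and> (\<forall>r\<in>E. h r \<le> h v)"
  using convex_top[OF face_of_imp_convex[OF E(1)] face_of_imp_closed[OF P E(1)] E(2,3) p]
  unfolding extreme_point_of_face[OF E(1)] by simp

lemma face_bot:
  assumes P: "convex P" "closed P" and E: "E face_of P" "collinear E" "nonconst h E"
    and p: "p \<in> E" "t < h p" "t \<notin> h ` E"
  shows "\<exists>v\<in>E. v extreme_point_of P \<and> t < h v \<and> (\<forall>r\<in>E. h v \<le> h r)"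
proof -
  interpret neg: affine_functional "- k" "- a" "\<lambda>x. - h x"
    by unfold_locales (simp add: h)
  have "\<exists>v\<in>E. v extreme_point_of P \<and> - h v < - t \<and> (\<forall>r\<in>E. - h r \<le> - h v)"
    by (rule neg.face_top[OF P E(1,2)]) (use E(3) p in auto)
  then show ?thesis by simp
qed

end

section \<open>Standard-form polyhedra and their slices\<close>

lemma convex_std_poly: "convex (std_poly M r)"
  unfolding convex_def std_poly_def
  by (auto simp: matrix_vector_right_distrib matrix_vector_mult_scaleR scaleR_add_left[symmetric])

lemma closed_std_poly: "closed (std_poly M r)"
proof -
  have "closed {x. M *v x = r}" by (intro closed_Collect_eq continuous_intros)
  moreover have "closed {x::real^'a. \<forall>i. 0 \<le> x $ i}"
    by (intro closed_Collect_all closed_Collect_le continuous_intros)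
  ultimately show ?thesis unfolding std_poly_def Collect_conj_eq by (rule closed_Int)
qed

lemma nonneg_perturb:
  fixes x d :: "real^'n"
  assumes "\<And>i. 0 \<le> x $ i" "\<And>i. x $ i = 0 \<Longrightarrow> d $ i = 0"
  obtains e where "0 < e" "\<And>i t. \<bar>t\<bar> \<le> e \<Longrightarrow> 0 \<le> x $ i + t * d $ i"
proof -
  let ?e = "\<lambda>i. if d $ i = 0 then 1 else x $ i / \<bar>d $ i\<bar>"
  define e where "e = Min (range ?e)"
  have pos: "0 < ?e i" for i using assms[of i] by (cases "x $ i = 0") auto
  have "e \<in> range ?e" unfolding e_def by (rule Min_in) auto
  then obtain j where "e = ?e j" by blast
  then have "0 < e" using pos[of j] by simp
  moreover have "0 \<le> x $ i + t * d $ i" if "\<bar>t\<bar> \<le> e" for i t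
  proof (cases "d $ i = 0")
    case False
    have "e \<le> ?e i" unfolding e_def by (rule Min_le) auto
    then have "\<bar>t\<bar> \<le> x $ i / \<bar>d $ i\<bar>" using that False by simp
    then have "\<bar>t * d $ i\<bar> \<le> x $ i" using False by (simp add: field_simps abs_mult)
    then show ?thesis by linarith
  qed (use assms in simp)
  ultimately show thesis using that by blast
qed

text \<open>The basic solution criterion: a kernel vector on the support of \<open>x\<close> allows
  small moves both ways, and the ends of a segment around \<open>x\<close> differ by such a
  vector.\<close>

lemma extreme_point_std_poly:
  "x extreme_point_of std_poly M r \<longleftrightarrow> x \<in> std_poly M r \<and>
    (\<forall>d. M *v d = 0 \<and> (\<forall>i. x $ i = 0 \<longrightarrow> d $ i = 0) \<longrightarrow> d = 0)"
proof (intro iffI conjI allI impI)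
  assume x: "x extreme_point_of std_poly M r"
  then show xP: "x \<in> std_poly M r" unfolding extreme_point_of_def by blast
  fix d assume d: "M *v d = 0 \<and> (\<forall>i. x $ i = 0 \<longrightarrow> d $ i = 0)"
  obtain e where e: "0 < e" "\<And>i t. \<bar>t\<bar> \<le> e \<Longrightarrow> 0 \<le> x $ i + t * d $ i"
    using nonneg_perturb[of x d] xP d unfolding std_poly_def by blast
  have P: "x + t *\<^sub>R d \<in> std_poly M r" if "\<bar>t\<bar> \<le> e" for t
    using xP d e(2)[OF that] unfolding std_poly_def
    by (simp add: matrix_vector_right_distrib matrix_vector_mult_scaleR)
  show "d = 0"
  proof (rule ccontr)
    assume "d \<noteq> 0"
    have "x = midpoint (x + (- e) *\<^sub>R d) (x + e *\<^sub>R d)"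
      unfolding midpoint_def by (simp add: scaleR_2[symmetric])
    moreover have "(x + e *\<^sub>R d) - (x + (- e) *\<^sub>R d) = (2 * e) *\<^sub>R d" by (simp add: scaleR_2[symmetric])
    then have "x + (- e) *\<^sub>R d \<noteq> x + e *\<^sub>R d" using e(1) \<open>d \<noteq> 0\<close>
      by (metis diff_self mult_eq_0_iff not_less_iff_gr_or_eq scaleR_eq_0_iff zero_neq_numeral)
    ultimately have "x \<in> open_segment (x + (- e) *\<^sub>R d) (x + e *\<^sub>R d)"
      by (metis midpoint_in_open_segment)
    then show False using x P[of "- e"] P[of e] e(1) unfolding extreme_point_of_def by auto
  qed
next
  assume x: "x \<in> std_poly M r \<and> (\<forall>d. M *v d = 0 \<and> (\<forall>i. x $ i = 0 \<longrightarrow> d $ i = 0) \<longrightarrow> d = 0)"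
  show "x extreme_point_of std_poly M r" unfolding extreme_point_of_def
  proof (intro conjI ballI notI)
    fix p q assume pq: "p \<in> std_poly M r" "q \<in> std_poly M r" "x \<in> open_segment p q"
    then obtain s where s: "p \<noteq> q" "0 < s" "s < 1" "x = (1 - s) *\<^sub>R p + s *\<^sub>R q"
      unfolding in_segment by auto
    have "(q - p) $ i = 0" if "x $ i = 0" for i
    proof -
      have "0 \<le> (1 - s) * p $ i" "0 \<le> s * q $ i" using pq s unfolding std_poly_def by auto
      moreover have "(1 - s) * p $ i + s * q $ i = 0" using that s by simp
      ultimately show ?thesis using s by (auto simp: add_nonneg_eq_0_iff)
    qed
    moreover have "M *v (q - p) = 0" using pq unfolding std_poly_def by (simp add: matrix_vector_mult_diff_distrib)
    ultimately have "q - p = 0" using x by blast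
    then show False using s by simp
  qed (use x in blast)
qed

text \<open>A point whose support is minimal among the points supported on the support of \<open>x\<close> is a vertex.\<close>

lemma ex_vertex_support:
  assumes "x \<in> std_poly M r"
  obtains w where "w extreme_point_of std_poly M r" "\<And>i. x $ i = 0 \<Longrightarrow> w $ i = 0"
proof -
  let ?S = "\<lambda>w. {i. w $ i \<noteq> 0}"
  let ?Q = "\<lambda>w. w \<in> std_poly M r \<and> (\<forall>i. x $ i = 0 \<longrightarrow> w $ i = 0)"
  obtain w where w: "?Q w" "\<And>z. ?Q z \<Longrightarrow> card (?S w) \<le> card (?S z)"
    using ex_has_least_nat[of ?Q x "\<lambda>w. card (?S w)"] assms by blast
  have "d = 0" if d: "M *v d = 0" "\<And>i. w $ i = 0 \<Longrightarrow> d $ i = 0" for d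
  proof (rule ccontr)
    assume "d \<noteq> 0"
    \<comment> \<open>Ratio test: moving along \<open>d\<close> until a first coordinate vanishes
      shrinks the support, against minimality.\<close>
    have noneg: False if d: "M *v d = 0" "\<And>i. w $ i = 0 \<Longrightarrow> d $ i = 0" and neg: "d $ j < 0" for d :: "real^'a" and j
    proof -
      let ?N = "{i. d $ i < 0}" and ?t = "\<lambda>i. w $ i / (- d $ i)"
      define t where "t = Min (?t ` ?N)"
      have "t \<in> ?t ` ?N" unfolding t_def by (rule Min_in) (use neg in auto)
      then obtain l where l: "d $ l < 0" "t = ?t l" by auto
      have t0: "0 \<le> t" using l w(1) unfolding std_poly_def by (auto intro!: divide_nonneg_neg)
      have "0 \<le> w $ i + t * d $ i" for i
      proof (cases "d $ i < 0")
        case True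
        have "t \<le> ?t i" unfolding t_def by (rule Min_le) (use True in auto)
        then show ?thesis using True by (simp add: field_simps)
      next
        case False
        then show ?thesis using w(1) t0 unfolding std_poly_def by simp
      qed
      then have "?Q (w + t *\<^sub>R d)" using w(1) d unfolding std_poly_def
        by (auto simp: matrix_vector_right_distrib matrix_vector_mult_scaleR)
      moreover have "?S (w + t *\<^sub>R d) \<subset> ?S w"
      proof
        show "?S (w + t *\<^sub>R d) \<subseteq> ?S w" using d(2) by auto
        have "(w + t *\<^sub>R d) $ l = 0" "w $ l \<noteq> 0" using l d(2)[of l] by (auto simp: field_simps)
        then show "?S (w + t *\<^sub>R d) \<noteq> ?S w" by blast
      qed
      then have "card (?S (w + t *\<^sub>R d)) < card (?S w)" by (intro psubset_card_mono) auto
      ultimately show False using w(2)[of "w + t *\<^sub>R d"] by simp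
    qed
    obtain j where "d $ j \<noteq> 0" using \<open>d \<noteq> 0\<close> by (auto simp: vec_eq_iff)
    moreover have "M *v (- d) = 0" using d(1) matrix_vector_mult_diff_distrib[of M 0 d] by simp
    ultimately show False using noneg[of d j] noneg[of "- d" j] d by (auto simp: neq_iff)
  qed
  then show thesis using w(1) that extreme_point_std_poly by blast
qed

text \<open>The minimal face of \<open>x\<close>.\<close>

lemma support_face:
  assumes "x \<in> std_poly M r"
  shows "{z \<in> std_poly M r. \<forall>i. x $ i = 0 \<longrightarrow> z $ i = 0} face_of std_poly M r"
  unfolding face_of_def
proof (intro conjI ballI impI)
  let ?E = "{z \<in> std_poly M r. \<forall>i. x $ i = 0 \<longrightarrow> z $ i = 0}"
  show "?E \<subseteq> std_poly M r" by blast
  have "?E = std_poly M r \<inter> {z. \<forall>i. x $ i = 0 \<longrightarrow> z $ i = 0}" by blast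
  moreover have "convex {z::real^'a. \<forall>i. x $ i = 0 \<longrightarrow> z $ i = 0}" unfolding convex_def by auto
  ultimately show "convex ?E" using convex_Int[OF convex_std_poly] by (simp only:)
  fix p q z assume pq: "p \<in> std_poly M r" "q \<in> std_poly M r" "z \<in> ?E" "z \<in> open_segment p q"
  then obtain s where s: "p \<noteq> q" "0 < s" "s < 1" "z = (1 - s) *\<^sub>R p + s *\<^sub>R q"
    unfolding in_segment by auto
  have "p $ i = 0 \<and> q $ i = 0" if "x $ i = 0" for i
  proof -
    have "0 \<le> (1 - s) * p $ i" "0 \<le> s * q $ i" using pq s unfolding std_poly_def by auto
    moreover have "z $ i = 0" using pq(3) that by blast
    then have "(1 - s) * p $ i + s * q $ i = 0" using s by simp
    ultimately show ?thesis using s by (auto simp: add_nonneg_eq_0_iff)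
  qed
  then show "p \<in> ?E" "q \<in> ?E" using pq by blast+
qed

lemma stack_below_mult:
  "stack_below A a *v x = r \<longleftrightarrow> A *v x = (\<chi> j. r $ Some j) \<and> a \<bullet> x = r $ None"
  unfolding vec_eq_iff split_option_all by (auto simp: stack_below_def matrix_vector_mul_component)

lemma stack_above_eq: "stack_above b B = stack_below B b"
  unfolding stack_above_def stack_below_def ..

text \<open>This is how the diameter of the stacked matrix bounds jumps inside a level.\<close>

lemma std_poly_stack_below:
  "{x \<in> std_poly A r. a \<bullet> x = t} = std_poly (stack_below A a) (\<chi> i. case i of None \<Rightarrow> t | Some j \<Rightarrow> r $ j)"
  unfolding std_poly_def stack_below_mult by auto

lemma extreme_point_slice:
  "x extreme_point_of {x \<in> std_poly A r. a \<bullet> x = t} \<longleftrightarrow> x \<in> std_poly A r \<and> a \<bullet> x = t \<and>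
    (\<forall>d. A *v d = 0 \<and> a \<bullet> d = 0 \<and> (\<forall>i. x $ i = 0 \<longrightarrow> d $ i = 0) \<longrightarrow> d = 0)"
  unfolding std_poly_stack_below extreme_point_std_poly stack_below_mult
  by (simp add: std_poly_stack_below[symmetric] zero_vec_def[symmetric] conj_assoc)

text \<open>Kernel vectors of \<open>A\<close> on the support of \<open>x\<close> are determined by
  their product with \<open>a\<close>, so the minimal face of \<open>x\<close> is collinear;
  \<open>ex_vertex_support\<close> finds a vertex on it.\<close>

lemma slice_vertex_edge:
  assumes x: "x extreme_point_of {x \<in> std_poly A r. a \<bullet> x = t}" and nv: "\<not> x extreme_point_of std_poly A r"
  obtains E w where "E face_of std_poly A r" "collinear E" "nonconst (\<lambda>x. a \<bullet> x) E" "x \<in> E" "w \<in> E"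
    "w extreme_point_of std_poly A r"
proof -
  have xP: "x \<in> std_poly A r" and
    inj: "\<And>d. A *v d = 0 \<Longrightarrow> a \<bullet> d = 0 \<Longrightarrow> (\<And>i. x $ i = 0 \<Longrightarrow> d $ i = 0) \<Longrightarrow> d = 0"
    using x unfolding extreme_point_slice by auto
  obtain d where d: "A *v d = 0" "\<And>i. x $ i = 0 \<Longrightarrow> d $ i = 0" "d \<noteq> 0"
    using nv xP unfolding extreme_point_std_poly by blast
  have ad: "a \<bullet> d \<noteq> 0" using inj d by blast
  let ?E = "{z \<in> std_poly A r. \<forall>i. x $ i = 0 \<longrightarrow> z $ i = 0}"
  obtain w where w: "w extreme_point_of std_poly A r" "\<And>i. x $ i = 0 \<Longrightarrow> w $ i = 0"
    using ex_vertex_support[OF xP] by blast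
  have wE: "w \<in> ?E" using w unfolding extreme_point_of_def by blast
  have xE: "x \<in> ?E" using xP by blast
  have "collinear ?E" unfolding collinear_def
  proof (intro exI[of _ d] ballI)
    fix p q assume pq: "p \<in> ?E" "q \<in> ?E"
    have "p - q - (a \<bullet> (p - q) / (a \<bullet> d)) *\<^sub>R d = 0"
    proof (rule inj)
      show "A *v (p - q - (a \<bullet> (p - q) / (a \<bullet> d)) *\<^sub>R d) = 0" using pq d(1) unfolding std_poly_def
        by (simp add: matrix_vector_mult_diff_distrib matrix_vector_mult_scaleR)
      show "a \<bullet> (p - q - (a \<bullet> (p - q) / (a \<bullet> d)) *\<^sub>R d) = 0" using ad by (simp add: inner_diff_right)
      show "(p - q - (a \<bullet> (p - q) / (a \<bullet> d)) *\<^sub>R d) $ i = 0" if "x $ i = 0" for i using that pq d(2) by simp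
    qed
    then show "\<exists>c. p - q = c *\<^sub>R d" by (metis eq_iff_diff_eq_0)
  qed
  moreover have "a \<bullet> x \<noteq> a \<bullet> w"
  proof
    assume "a \<bullet> x = a \<bullet> w"
    then have "x - w = 0" using xP wE unfolding std_poly_def
      by (intro inj) (auto simp: matrix_vector_mult_diff_distrib inner_diff_right)
    then show False using w nv by simp
  qed
  then have "nonconst (\<lambda>x. a \<bullet> x) ?E" using nonconstI[OF xE wE] by blast
  ultimately show thesis using that[OF support_face[OF xP] _ _ xE wE w(1)] by blast
qed

section \<open>Matrices of diameter zero\<close>

text \<open>The positive part \<open>p\<close> and negative part \<open>n\<close> of
  \<open>z\<close> lie in one polyhedron of \<open>A\<close>. Vertices found within their disjoint
  supports coincide, hence are 0, and so is the right-hand side.\<close>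

lemma kernel_pos_part:
  assumes A: "mat_diam A = 0" and z: "A *v z = 0"
  shows "A *v (\<chi> i. max (z $ i) 0) = 0"
proof -
  define p n where "p = (\<chi> i. max (z $ i) 0)" and "n = (\<chi> i. max (- z $ i) 0)"
  have "p - n = z" unfolding p_def n_def by (auto simp: vec_eq_iff)
  then have "A *v n = A *v p" using z matrix_vector_mult_diff_distrib[of A p n] by simp
  then have pn: "p \<in> std_poly A (A *v p)" "n \<in> std_poly A (A *v p)"
    unfolding std_poly_def p_def n_def by auto
  obtain w where w: "w extreme_point_of std_poly A (A *v p)" "\<And>i. p $ i = 0 \<Longrightarrow> w $ i = 0"
    using ex_vertex_support[OF pn(1)] by blast
  obtain w' where w': "w' extreme_point_of std_poly A (A *v p)" "\<And>i. n $ i = 0 \<Longrightarrow> w' $ i = 0"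
    using ex_vertex_support[OF pn(2)] by blast
  have "near (std_poly A (A *v p)) 0 w w'" using mat_diam_near[OF _ w(1) w'(1)] A by (simp add: zero_enat_def)
  then have "w = w'" unfolding near_def by simp
  moreover have "p $ i = 0 \<or> n $ i = 0" for i unfolding p_def n_def by auto
  ultimately have "w = 0" using w(2) w'(2) by (metis vec_eq_iff zero_index)
  then have "A *v p = 0" using w(1) unfolding extreme_point_of_def std_poly_def by auto
  then show ?thesis unfolding p_def .
qed

text \<open>Subtracting a large multiple of \<open>w\<close> from \<open>z\<close> leaves the
  restriction of \<open>z\<close> to the zeros of \<open>w\<close> as positive part.\<close>

lemma kernel_restrict:
  fixes z w :: "real^'n"
  assumes A: "mat_diam A = 0" and zw: "A *v z = 0" "A *v w = 0" "\<And>i. 0 \<le> z $ i" "\<And>i. 0 \<le> w $ i"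
  shows "A *v (\<chi> i. if w $ i = 0 then z $ i else 0) = 0"
proof -
  define s where "s = (\<Sum>i\<in>UNIV. z $ i / w $ i)"
  have "z $ i \<le> s * w $ i" if "w $ i \<noteq> 0" for i
  proof -
    have "0 < w $ i" using that zw(4)[of i] by simp
    moreover have "z $ i / w $ i \<le> s" unfolding s_def
      by (rule member_le_sum) (use zw(3,4) in auto)
    ultimately show ?thesis by (simp add: field_simps)
  qed
  then have "(\<chi> i. if w $ i = 0 then z $ i else 0) = (\<chi> i. max ((z - s *\<^sub>R w) $ i) 0)"
    using zw(3) by (auto simp: vec_eq_iff max_def intro: order.antisym)
  moreover have "A *v (z - s *\<^sub>R w) = 0"
    using zw by (simp add: matrix_vector_mult_diff_distrib matrix_vector_mult_scaleR)
  ultimately show ?thesis using kernel_pos_part[OF A] by metis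
qed

text \<open>If every polyhedron of \<open>A\<close> has at most one vertex, then the kernel of \<open>A\<close> is a vector lattice,
  so \<open>q - p\<close> splits into two disjoint kernel vectors, which span all kernel vectors
  supported on the union of the supports of \<open>p\<close> and \<open>q\<close>.\<close>

lemma kernel_span_slice_vertices:
  fixes A :: "real^'n^'m" and p q :: "real^'n"
  assumes A: "mat_diam A = 0" and ne: "p \<noteq> q"
    and p: "p extreme_point_of {x \<in> std_poly A r. a \<bullet> x = t}"
    and q: "q extreme_point_of {x \<in> std_poly A r. a \<bullet> x = t}"
    and z: "A *v z = 0" "a \<bullet> z = 0" "\<And>i. p $ i = 0 \<Longrightarrow> q $ i = 0 \<Longrightarrow> z $ i = 0"
  shows "\<exists>c. z = c *\<^sub>R (q - p)"
proof -
  define u v where "u = (\<chi> i. max ((q - p) $ i) 0)" and "v = (\<chi> i. max ((p - q) $ i) 0)"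
  have P: "p \<in> std_poly A r" "q \<in> std_poly A r" "a \<bullet> p = t" "a \<bullet> q = t"
    using p q unfolding extreme_point_slice by auto
  then have pos: "\<And>i. 0 \<le> p $ i" "\<And>i. 0 \<le> q $ i" unfolding std_poly_def by auto
  have K: "A *v (q - p) = 0" "A *v (p - q) = 0"
    using P unfolding std_poly_def by (auto simp: matrix_vector_mult_diff_distrib)
  have Ku: "A *v u = 0" and Kv: "A *v v = 0"
    unfolding u_def v_def using kernel_pos_part[OF A] K by blast+
  have upos: "0 \<le> u $ i" and vpos: "0 \<le> v $ i" for i unfolding u_def v_def by auto
  have uv: "u - v = q - p" unfolding u_def v_def by (auto simp: vec_eq_iff max_def)
  have disj: "u $ i = 0 \<or> v $ i = 0" for i unfolding u_def v_def by auto
  have su: "u $ i = 0" if "q $ i = 0" for i using that pos[of i] unfolding u_def by auto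
  have sv: "v $ i = 0" if "p $ i = 0" for i using that pos[of i] unfolding v_def by auto
  have injp: "d = 0" if "A *v d = 0" "a \<bullet> d = 0" "\<And>i. p $ i = 0 \<Longrightarrow> d $ i = 0" for d
    using p that unfolding extreme_point_slice by blast
  have injq: "d = 0" if "A *v d = 0" "a \<bullet> d = 0" "\<And>i. q $ i = 0 \<Longrightarrow> d $ i = 0" for d
    using q that unfolding extreme_point_slice by blast
  have auv: "a \<bullet> u = a \<bullet> v" using P arg_cong[OF uv, of "\<lambda>x. a \<bullet> x"] by (simp add: inner_diff_right)
  \<comment> \<open>If \<open>a\<close> vanished on \<open>u\<close>, it would vanish on
    \<open>v\<close> too, and the vertex conditions at \<open>q\<close> and \<open>p\<close> would
    give \<open>u = v = 0\<close>.\<close>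
  have au: "a \<bullet> u \<noteq> 0"
  proof
    assume "a \<bullet> u = 0"
    then have "u = 0" "v = 0" using injq[OF Ku _ su] injp[OF Kv _ sv] auv by auto
    then show False using uv ne by simp
  qed
  have linep: "d = (a \<bullet> d / (a \<bullet> v)) *\<^sub>R v" if "A *v d = 0" "\<And>i. p $ i = 0 \<Longrightarrow> d $ i = 0" for d
  proof -
    have "d - (a \<bullet> d / (a \<bullet> v)) *\<^sub>R v = 0"
      by (rule injp) (use that Kv sv au auv in
        \<open>auto simp: matrix_vector_mult_diff_distrib matrix_vector_mult_scaleR inner_diff_right\<close>)
    then show ?thesis by simp
  qed
  have lineq: "d = (a \<bullet> d / (a \<bullet> u)) *\<^sub>R u" if "A *v d = 0" "\<And>i. q $ i = 0 \<Longrightarrow> d $ i = 0" for d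
  proof -
    have "d - (a \<bullet> d / (a \<bullet> u)) *\<^sub>R u = 0"
      by (rule injq) (use that Ku su au in
        \<open>auto simp: matrix_vector_mult_diff_distrib matrix_vector_mult_scaleR inner_diff_right\<close>)
    then show ?thesis by simp
  qed
  have span: "\<exists>l m. d = l *\<^sub>R u + m *\<^sub>R v"
    if d: "A *v d = 0" "\<And>i. 0 \<le> d $ i" "\<And>i. p $ i = 0 \<Longrightarrow> q $ i = 0 \<Longrightarrow> d $ i = 0" for d
  proof -
    \<comment> \<open>\<open>y\<close> is the part of \<open>d\<close> outside both supports. There
      \<open>p\<close> and \<open>q\<close> agree, so \<open>y\<close> lives on the support of
      \<open>p\<close> and is a multiple of \<open>v\<close>; as \<open>v\<close> is zero there,
      \<open>y = 0\<close> and \<open>d\<close> splits into \<open>y1\<close> and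
      \<open>y2\<close>.\<close>
    define y1 y2 y where "y1 = (\<chi> i. if v $ i = 0 then d $ i else 0)"
      and "y2 = (\<chi> i. if u $ i = 0 then d $ i else 0)" and "y = (\<chi> i. if u $ i = 0 then y1 $ i else 0)"
    have Ky1: "A *v y1 = 0" unfolding y1_def by (rule kernel_restrict[OF A d(1) Kv d(2) vpos])
    have Ky2: "A *v y2 = 0" unfolding y2_def by (rule kernel_restrict[OF A d(1) Ku d(2) upos])
    have "0 \<le> y1 $ i" for i unfolding y1_def using d(2) by simp
    then have Ky: "A *v y = 0" unfolding y_def by (rule kernel_restrict[OF A Ky1 Ku _ upos])
    have pq: "p $ i = q $ i" if "u $ i = 0" "v $ i = 0" for i
      using arg_cong[OF uv, of "\<lambda>x. x $ i"] that by simp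
    have "y $ i = 0" if "p $ i = 0" for i unfolding y_def y1_def using d(3)[of i] pq[of i] that by auto
    from linep[OF Ky this] obtain l where l: "y = l *\<^sub>R v" by blast
    have d0: "d $ i = 0" if "u $ i = 0" "v $ i = 0" for i
    proof -
      have "d $ i = y $ i" unfolding y_def y1_def using that by simp
      also have "\<dots> = 0" unfolding l using that by simp
      finally show ?thesis .
    qed
    have "y1 $ i = 0" if "q $ i = 0" for i unfolding y1_def using d0 su that by auto
    from lineq[OF Ky1 this] obtain l1 where l1: "y1 = l1 *\<^sub>R u" by blast
    have "y2 $ i = 0" if "p $ i = 0" for i unfolding y2_def using d0 sv that by auto
    from linep[OF Ky2 this] obtain l2 where l2: "y2 = l2 *\<^sub>R v" by blast
    have "d $ i = y1 $ i + y2 $ i" for i unfolding y1_def y2_def using d0[of i] disj[of i] by auto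
    then have "d = y1 + y2" by (simp add: vec_eq_iff)
    then show ?thesis using l1 l2 by blast
  qed
  define zp zn where "zp = (\<chi> i. max (z $ i) 0)" and "zn = (\<chi> i. max ((- z) $ i) 0)"
  have "A *v (- z) = 0" using z(1) matrix_vector_mult_diff_distrib[of A 0 z] by simp
  then have Kz: "A *v zp = 0" "A *v zn = 0" unfolding zp_def zn_def using kernel_pos_part[OF A] z(1) by blast+
  obtain l m where 1: "zp = l *\<^sub>R u + m *\<^sub>R v" using span[OF Kz(1)] z(3) unfolding zp_def by auto
  obtain l' m' where 2: "zn = l' *\<^sub>R u + m' *\<^sub>R v" using span[OF Kz(2)] z(3) unfolding zn_def by auto
  have "z = zp - zn" unfolding zp_def zn_def by (auto simp: vec_eq_iff max_def)
  then have zuv: "z = (l - l') *\<^sub>R u + (m - m') *\<^sub>R v" unfolding 1 2 by (simp add: algebra_simps)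
  have "a \<bullet> z = (l - l') * (a \<bullet> u) + (m - m') * (a \<bullet> v)" unfolding zuv by (simp add: inner_add_right)
  \<comment> \<open>Since \<open>a \<bullet> u = a \<bullet> v\<close>, the coefficients are
    opposite, leaving a multiple of \<open>u - v\<close>.\<close>
  then have "(l - l' + (m - m')) * (a \<bullet> u) = 0" using z(2) auv by (simp add: distrib_right)
  then have "m - m' = - (l - l')" using au by auto
  with zuv have "z = (l - l') *\<^sub>R u + (- (l - l')) *\<^sub>R v" by (simp only:)
  then have "z = (l - l') *\<^sub>R (u - v)"
    by (simp only: scaleR_diff_right scaleR_minus_left add_uminus_conv_diff)
  then show ?thesis using uv by metis
qed

text \<open>The midpoint of two slice vertices has the union of their supports as support, so by
  \<open>kernel_span_slice_vertices\<close> its minimal face is collinear and the vertices are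
  adjacent.\<close>

lemma mat_diam_stack_below_le_1:
  assumes A: "mat_diam A = 0"
  shows "mat_diam (stack_below A a) \<le> 1"
  unfolding mat_diam_def poly_diam_def
proof (intro SUP_least, clarsimp)
  fix r p q
  assume "p extreme_point_of std_poly (stack_below A a) r" "q extreme_point_of std_poly (stack_below A a) r"
  moreover let ?r = "\<chi> j. r $ Some j" and ?t = "r $ None"
  let ?S = "{x \<in> std_poly A ?r. a \<bullet> x = ?t}"
  have S: "std_poly (stack_below A a) r = ?S" unfolding std_poly_def stack_below_mult by auto
  ultimately have p: "p extreme_point_of ?S" and q: "q extreme_point_of ?S" by simp_all
  have "near ?S 1 p q"
  proof (cases "p = q")
    case True
    then show ?thesis using near_mono[OF near_refl] by simp
  next
    case False
    have pS: "p \<in> ?S" and qS: "q \<in> ?S" using p q unfolding extreme_point_of_def by auto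
    then have pos: "\<And>i. 0 \<le> p $ i" "\<And>i. 0 \<le> q $ i" unfolding std_poly_def by auto
    define m where "m = midpoint p q"
    have "convex ?S" unfolding S[symmetric] by (rule convex_std_poly)
    from closed_segment_subset[OF pS qS this] have mS: "m \<in> std_poly (stack_below A a) r"
      unfolding m_def S by (rule subsetD) simp
    have m0: "p $ i = 0 \<and> q $ i = 0" if "m $ i = 0" for i
      using that pos[of i] unfolding m_def midpoint_def by (simp add: add_nonneg_eq_0_iff)
    let ?T = "{z \<in> ?S. \<forall>i. m $ i = 0 \<longrightarrow> z $ i = 0}"
    have "?T face_of ?S" using support_face[OF mS] unfolding S .
    moreover have "collinear ?T" unfolding collinear_def
    proof (intro exI[of _ "q - p"] ballI)
      fix x y assume "x \<in> ?T" "y \<in> ?T"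
      then show "\<exists>c. x - y = c *\<^sub>R (q - p)"
        by (intro kernel_span_slice_vertices[OF A False p q])
          (auto simp: std_poly_def matrix_vector_mult_diff_distrib inner_diff_right m_def midpoint_def)
    qed
    ultimately have "vertex_adj ?S p q"
      by (rule vertex_adj_collinear_face) (use pS qS m0 p q False in auto)
    then show ?thesis by (rule near_adj)
  qed
  then show "poly_dist (std_poly (stack_below A a) r) p q \<le> 1"
    unfolding S one_enat_def poly_dist_le_iff .
qed

section \<open>The 2-sum polyhedron\<close>

locale fiber_product =
  A: affine_functional k a f + B: affine_functional l b g
  for k a f l b g +
  fixes P :: "'a::euclidean_space set" and Q :: "'b::euclidean_space set" and R
  assumes R: "R = {(x, y). x \<in> P \<and> y \<in> Q \<and> f x = g y}"
begin

text \<open>\<open>E \<times> G\<close> is a face of \<open>P \<times> Q\<close>, and equality of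
  levels cuts out a hyperplane section.\<close>

lemma face_fiber_product:
  assumes "E face_of P" "G face_of Q"
  shows "{(x, y). x \<in> E \<and> y \<in> G \<and> f x = g y} face_of R"
proof -
  let ?H = "{z. (a, - b) \<bullet> z = l - k}"
  have H: "f x = g y \<longleftrightarrow> (x, y) \<in> ?H" for x y unfolding A.h B.h by (auto simp: inner_Pair algebra_simps)
  have "(E \<times> G) face_of (P \<times> Q)" using assms by (simp add: face_of_Times_eq)
  then have "(E \<times> G) \<inter> ?H face_of (P \<times> Q) \<inter> ?H" by (rule face_of_slice[OF _ convex_hyperplane])
  moreover have "(P \<times> Q) \<inter> ?H = R" unfolding R using H by auto
  moreover have "(E \<times> G) \<inter> ?H = {(x, y). x \<in> E \<and> y \<in> G \<and> f x = g y}" using H by auto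
  ultimately show ?thesis by simp
qed

lemma extreme_point_fiber_product:
  assumes "E face_of P" "G face_of Q" "x \<in> E" "y \<in> G" "f x = g y"
    and "\<And>x' y'. x' \<in> E \<Longrightarrow> y' \<in> G \<Longrightarrow> f x' = g y' \<Longrightarrow> x' = x \<and> y' = y"
  shows "(x, y) extreme_point_of R"
proof -
  have "{(x, y). x \<in> E \<and> y \<in> G \<and> f x = g y} = {(x, y)}" using assms(3-5) by (auto dest: assms(6))
  then show ?thesis using face_fiber_product[OF assms(1,2)] by (simp add: face_of_singleton)
qed

text \<open>The levels change at rates \<open>a \<bullet> u\<close> and
  \<open>b \<bullet> v\<close>, not both zero. Equal levels make the steps in \<open>E\<close> and
  \<open>G\<close> proportional to \<open>b \<bullet> v\<close> and \<open>a \<bullet> u\<close>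
  with a common factor.\<close>

lemma collinear_fiber_product:
  assumes "collinear E" "collinear G" "nonconst f E \<or> nonconst g G"
  shows "collinear {(x, y). x \<in> E \<and> y \<in> G \<and> f x = g y}"
proof -
  obtain u where u: "\<And>x y. x \<in> E \<Longrightarrow> y \<in> E \<Longrightarrow> \<exists>c. x - y = c *\<^sub>R u"
    using assms(1) unfolding collinear_def by blast
  obtain v where v: "\<And>x y. x \<in> G \<Longrightarrow> y \<in> G \<Longrightarrow> \<exists>c. x - y = c *\<^sub>R v"
    using assms(2) unfolding collinear_def by blast
  have f: "f x - f y = a \<bullet> (x - y)" for x y unfolding A.h by (simp add: inner_diff_right)
  have g: "g x - g y = b \<bullet> (x - y)" for x y unfolding B.h by (simp add: inner_diff_right)
  have nz: "a \<bullet> u \<noteq> 0 \<or> b \<bullet> v \<noteq> 0"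
  proof (rule ccontr)
    assume "\<not> (a \<bullet> u \<noteq> 0 \<or> b \<bullet> v \<noteq> 0)"
    then have z: "a \<bullet> u = 0" "b \<bullet> v = 0" by simp_all
    have "f x = f y" if xy: "x \<in> E" "y \<in> E" for x y
    proof -
      obtain c where "x - y = c *\<^sub>R u" using u xy by blast
      then show ?thesis using f[of x y] z by simp
    qed
    moreover have "g x = g y" if xy: "x \<in> G" "y \<in> G" for x y
    proof -
      obtain c where "x - y = c *\<^sub>R v" using v xy by blast
      then show ?thesis using g[of x y] z by simp
    qed
    ultimately show False using assms(3) unfolding nonconst_def by blast
  qed
  show ?thesis unfolding collinear_def
  proof (intro exI[of _ "((b \<bullet> v) *\<^sub>R u, (a \<bullet> u) *\<^sub>R v)"] ballI)
    fix z z' assume z: "z \<in> {(x, y). x \<in> E \<and> y \<in> G \<and> f x = g y}" "z' \<in> {(x, y). x \<in> E \<and> y \<in> G \<and> f x = g y}"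
    have zE: "fst z \<in> E" "fst z' \<in> E" "snd z \<in> G" "snd z' \<in> G" using z by auto
    obtain c where c: "fst z - fst z' = c *\<^sub>R u" using u[OF zE(1,2)] by blast
    obtain d where d: "snd z - snd z' = d *\<^sub>R v" using v[OF zE(3,4)] by blast
    have "f (fst z) - f (fst z') = g (snd z) - g (snd z')" using z by auto
    then have cd: "c * (a \<bullet> u) = d * (b \<bullet> v)"
      using f[of "fst z" "fst z'"] g[of "snd z" "snd z'"] unfolding c d by simp
    define s where "s = (if b \<bullet> v \<noteq> 0 then c / (b \<bullet> v) else d / (a \<bullet> u))"
    have "c = s * (b \<bullet> v)" "d = s * (a \<bullet> u)" unfolding s_def using cd nz by (auto simp: field_simps)
    then have "z - z' = s *\<^sub>R ((b \<bullet> v) *\<^sub>R u, (a \<bullet> u) *\<^sub>R v)" using c d by (simp add: prod_eq_iff)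
    then show "\<exists>s. z - z' = s *\<^sub>R ((b \<bullet> v) *\<^sub>R u, (a \<bullet> u) *\<^sub>R v)" ..
  qed
qed

lemma near_tandem:
  assumes "E face_of P" "collinear E" "G face_of Q" "collinear G" "nonconst f E \<or> nonconst g G"
    and "x \<in> E" "x' \<in> E" "y \<in> G" "y' \<in> G" "(x, y) extreme_point_of R" "(x', y') extreme_point_of R"
  shows "near R 1 (x, y) (x', y')"
proof (cases "(x, y) = (x', y')")
  case True
  then show ?thesis using near_mono[OF near_refl] by simp
next
  case False
  have "(x, y) \<in> R" "(x', y') \<in> R" using assms(10,11) unfolding extreme_point_of_def by auto
  then have "f x = g y" "f x' = g y'" unfolding R by auto
  then have "vertex_adj R (x, y) (x', y')"
    using vertex_adj_collinear_face[OF face_fiber_product[OF assms(1,3)] collinear_fiber_product[OF assms(2,4,5)]]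
      assms(6-11) False by auto
  then show ?thesis by (rule near_adj)
qed

text \<open>As \<open>{y}\<close> is a face of \<open>Q\<close>, the slice times \<open>{y}\<close>
  is a face of \<open>R\<close>, so edges of the slice become edges of \<open>R\<close>.\<close>

lemma vertex_adj_fst:
  assumes y: "y extreme_point_of Q" and adj: "vertex_adj {x \<in> P. f x = g y} v w"
    and P: "P face_of P"
  shows "vertex_adj R (v, y) (w, y)"
proof -
  let ?S = "{x \<in> P. f x = g y}"
  have face: "F \<times> {y} face_of R" if "F face_of ?S" for F
  proof -
    have "{(x, y'). x \<in> P \<and> y' \<in> {y} \<and> f x = g y'} = ?S \<times> {y}" by auto
    then have "?S \<times> {y} face_of R" using face_fiber_product[OF P face_of_singleton[THEN iffD2, OF y]] by simp
    moreover have "F \<times> {y} face_of ?S \<times> {y}" using that by (simp add: face_of_Times_eq face_of_refl)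
    ultimately show ?thesis using face_of_trans by blast
  qed
  have "closed_segment (v, y) (w, y) = closed_segment v w \<times> {y}"
    unfolding closed_segment_def by (auto simp: scaleR_left_distrib[symmetric])
  moreover have "{v} \<times> {y} = {(v, y)}" "{w} \<times> {y} = {(w, y)}" by auto
  ultimately show ?thesis
    using adj face[of "closed_segment v w"] face[of "{v}"] face[of "{w}"]
    unfolding vertex_adj_def by (simp add: face_of_singleton)
qed

lemma vertex_adj_snd:
  assumes x: "x extreme_point_of P" and adj: "vertex_adj {y \<in> Q. g y = f x} v w"
    and Q: "Q face_of Q"
  shows "vertex_adj R (x, v) (x, w)"
proof -
  let ?S = "{y \<in> Q. g y = f x}"
  have face: "{x} \<times> F face_of R" if "F face_of ?S" for F
  proof -
    have "{(x', y). x' \<in> {x} \<and> y \<in> Q \<and> f x' = g y} = {x} \<times> ?S" by auto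
    then have "{x} \<times> ?S face_of R" using face_fiber_product[OF face_of_singleton[THEN iffD2, OF x] Q] by simp
    moreover have "{x} \<times> F face_of {x} \<times> ?S" using that by (simp add: face_of_Times_eq face_of_refl)
    ultimately show ?thesis using face_of_trans by blast
  qed
  have "closed_segment (x, v) (x, w) = {x} \<times> closed_segment v w"
    unfolding closed_segment_def by (auto simp: scaleR_left_distrib[symmetric])
  moreover have "{x} \<times> {v} = {(x, v)}" "{x} \<times> {w} = {(x, w)}" by auto
  ultimately show ?thesis
    using adj face[of "closed_segment v w"] face[of "{v}"] face[of "{w}"]
    unfolding vertex_adj_def by (simp add: face_of_singleton)
qed

end

section \<open>Vertices of the 2-sum polyhedron\<close>

text \<open>Small moves both ways along \<open>(d, e)\<close> stay in \<open>R\<close>, which at a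
  vertex forces the direction to be zero.\<close>

lemma two_sum_rigid:
  assumes R: "R = {(x, y). x \<in> std_poly A cA \<and> y \<in> std_poly B cB \<and> a \<bullet> x = c - b \<bullet> y}"
    and ext: "(x, y) extreme_point_of R"
    and d: "A *v d = 0" "\<And>i. x $ i = 0 \<Longrightarrow> d $ i = 0"
    and e: "B *v e = 0" "\<And>i. y $ i = 0 \<Longrightarrow> e $ i = 0"
    and de: "a \<bullet> d + b \<bullet> e = 0"
  shows "d = 0 \<and> e = 0"
proof -
  have xyR: "(x, y) \<in> R" using ext unfolding extreme_point_of_def by blast
  then have xy: "x \<in> std_poly A cA" "y \<in> std_poly B cB" "a \<bullet> x = c - b \<bullet> y" unfolding R by auto
  obtain s where s: "0 < s" "\<And>i t. \<bar>t\<bar> \<le> s \<Longrightarrow> 0 \<le> x $ i + t * d $ i"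
    using nonneg_perturb[of x d] xy(1) d unfolding std_poly_def by blast
  obtain s' where s': "0 < s'" "\<And>i t. \<bar>t\<bar> \<le> s' \<Longrightarrow> 0 \<le> y $ i + t * e $ i"
    using nonneg_perturb[of y e] xy(2) e unfolding std_poly_def by blast
  define r where "r = min s s'"
  have r: "0 < r" unfolding r_def using s s' by simp
  have inR: "(x, y) + t *\<^sub>R (d, e) \<in> R" if "\<bar>t\<bar> \<le> r" for t
  proof -
    have "\<bar>t\<bar> \<le> s" "\<bar>t\<bar> \<le> s'" using that unfolding r_def by auto
    moreover have "t * (a \<bullet> d + b \<bullet> e) = 0" using de by simp
    ultimately show ?thesis using xy d(1) e(1) s(2) s'(2) unfolding R std_poly_def
      by (simp add: matrix_vector_right_distrib matrix_vector_mult_scaleR inner_add_right distrib_left)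
  qed
  have "(d, e) = 0"
  proof (rule ccontr)
    assume ne: "(d, e) \<noteq> 0"
    have "(x, y) = midpoint ((x, y) + (- r) *\<^sub>R (d, e)) ((x, y) + r *\<^sub>R (d, e))"
      unfolding midpoint_def by (simp add: scaleR_2[symmetric])
    moreover have "((x, y) + r *\<^sub>R (d, e)) - ((x, y) + (- r) *\<^sub>R (d, e)) = (2 * r) *\<^sub>R (d, e)"
      by (simp add: scaleR_2[symmetric])
    then have "(x, y) + (- r) *\<^sub>R (d, e) \<noteq> (x, y) + r *\<^sub>R (d, e)" using r ne
      by (metis diff_self mult_eq_0_iff not_less_iff_gr_or_eq scaleR_eq_0_iff zero_neq_numeral)
    ultimately have "(x, y) \<in> open_segment ((x, y) + (- r) *\<^sub>R (d, e)) ((x, y) + r *\<^sub>R (d, e))"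
      by (metis midpoint_in_open_segment)
    then show False using ext inR[of "- r"] inR[of r] r unfolding extreme_point_of_def by auto
  qed
  then show ?thesis by (simp add: zero_prod_def)
qed

lemma two_sum_extreme_cases:
  assumes R: "R = {(x, y). x \<in> std_poly A cA \<and> y \<in> std_poly B cB \<and> a \<bullet> x = c - b \<bullet> y}"
    and ext: "(x, y) extreme_point_of R"
  shows "x extreme_point_of {x' \<in> std_poly A cA. a \<bullet> x' = a \<bullet> x}"
    and "y extreme_point_of {y' \<in> std_poly B cB. b \<bullet> y' = b \<bullet> y}"
    and "x extreme_point_of std_poly A cA \<or> y extreme_point_of std_poly B cB"
proof -
  note rigid = two_sum_rigid[OF R ext]
  have "(x, y) \<in> R" using ext unfolding extreme_point_of_def by blast
  then have xy: "x \<in> std_poly A cA" "y \<in> std_poly B cB" unfolding R by auto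
  show "x extreme_point_of {x' \<in> std_poly A cA. a \<bullet> x' = a \<bullet> x}"
    unfolding extreme_point_slice using xy rigid[of _ 0] by auto
  show "y extreme_point_of {y' \<in> std_poly B cB. b \<bullet> y' = b \<bullet> y}"
    unfolding extreme_point_slice using xy rigid[of 0] by auto
  show "x extreme_point_of std_poly A cA \<or> y extreme_point_of std_poly B cB"
  proof (rule ccontr)
    assume "\<not> ?thesis"
    then obtain d e where d: "A *v d = 0" "\<And>i. x $ i = 0 \<Longrightarrow> d $ i = 0" "d \<noteq> 0"
      and e: "B *v e = 0" "\<And>i. y $ i = 0 \<Longrightarrow> e $ i = 0" "e \<noteq> 0"
      using xy unfolding extreme_point_std_poly by blast
    have "b \<bullet> e \<noteq> 0" using rigid[of 0 e] e by auto
    then have "(b \<bullet> e) *\<^sub>R d = 0 \<and> (- (a \<bullet> d)) *\<^sub>R e = 0"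
      using d e by (intro rigid) (auto simp: matrix_vector_mult_scaleR linear_neg[OF matrix_vector_mul_linear])
    then show False using \<open>b \<bullet> e \<noteq> 0\<close> d(3) by simp
  qed
qed

section \<open>The diameter bound\<close>

lemma near_two_sum:
  fixes A :: "real^'n1^'m1" and B :: "real^'n2^'m2"
  assumes R: "R = {(x, y). x \<in> std_poly A cA \<and> y \<in> std_poly B cB \<and> a \<bullet> x = c - b \<bullet> y}"
    and dA: "mat_diam A = enat dA" and DA: "mat_diam (stack_below A a) = enat DA"
    and dB: "mat_diam B = enat dB" and DB: "mat_diam (stack_below B b) = enat DB"
    and ext: "v extreme_point_of R" "w extreme_point_of R"
  shows "near R (dA * (DA + 1) + dB * (DB + 1) + 1) v w"
proof -
  let ?P = "std_poly A cA" and ?Q = "std_poly B cB"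
  let ?f = "\<lambda>x. a \<bullet> x" and ?g = "\<lambda>y. c - b \<bullet> y"
  interpret fiber_product 0 a ?f c "- b" ?g ?P ?Q R
    by unfold_locales (simp_all add: R)
  have nonconst_g: "nonconst ?g G \<longleftrightarrow> nonconst (\<lambda>y. b \<bullet> y) G" for G unfolding nonconst_def by simp
  note slice = two_sum_extreme_cases[OF R]
  have level: "a \<bullet> x = c - b \<bullet> y" if "(x, y) extreme_point_of R" for x y
    using that unfolding extreme_point_of_def R by auto
  let ?FA = "\<lambda>E. E face_of ?P \<and> collinear E" and ?FB = "\<lambda>G. G face_of ?Q \<and> collinear G"
  interpret climbing "\<lambda>x. x extreme_point_of ?P" ?FA ?f dA DA "\<lambda>y. y extreme_point_of ?Q" ?FB ?g dB DB
    "\<lambda>x y. (x, y) extreme_point_of R" "\<lambda>x y x' y' n. near R n (x, y) (x', y')"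
  proof unfold_locales
    show "\<exists>r\<in>E. a \<bullet> r = t" if "?FA E" "p \<in> E" "q \<in> E" "a \<bullet> p \<le> t" "t \<le> a \<bullet> q" for E p q t
      using that A.convex_between face_of_imp_convex by blast
    show "\<exists>r\<in>E. c - b \<bullet> r = t" if "?FB E" "p \<in> E" "q \<in> E" "c - b \<bullet> p \<le> t" "t \<le> c - b \<bullet> q" for E p q t
      using that B.convex_between face_of_imp_convex by blast
    show "p = q" if "?FA E" "nonconst ?f E" "p \<in> E" "q \<in> E" "a \<bullet> p = a \<bullet> q" for E p q
      using that A.collinear_inj by blast
    show "p = q" if "?FB E" "nonconst ?g E" "p \<in> E" "q \<in> E" "c - b \<bullet> p = c - b \<bullet> q" for E p q
      using that B.collinear_inj by blast
    show "\<exists>v\<in>E. v extreme_point_of ?P \<and> a \<bullet> v < t \<and> (\<forall>r\<in>E. a \<bullet> r \<le> a \<bullet> v)"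
      if "?FA E" "nonconst ?f E" "p \<in> E" "a \<bullet> p < t" "t \<notin> ?f ` E" for E p t
      using that A.face_top[OF convex_std_poly closed_std_poly] by blast
    show "\<exists>v\<in>E. v extreme_point_of ?Q \<and> c - b \<bullet> v < t \<and> (\<forall>r\<in>E. c - b \<bullet> r \<le> c - b \<bullet> v)"
      if "?FB E" "nonconst ?g E" "p \<in> E" "c - b \<bullet> p < t" "t \<notin> ?g ` E" for E p t
      using that B.face_top[OF convex_std_poly closed_std_poly] by blast
    show "\<exists>v\<in>E. v extreme_point_of ?P \<and> t < a \<bullet> v \<and> (\<forall>r\<in>E. a \<bullet> v \<le> a \<bullet> r)"
      if "?FA E" "nonconst ?f E" "p \<in> E" "t < a \<bullet> p" "t \<notin> ?f ` E" for E p t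
      using that A.face_bot[OF convex_std_poly closed_std_poly] by blast
    show "\<exists>v\<in>E. v extreme_point_of ?Q \<and> t < c - b \<bullet> v \<and> (\<forall>r\<in>E. c - b \<bullet> v \<le> c - b \<bullet> r)"
      if "?FB E" "nonconst ?g E" "p \<in> E" "t < c - b \<bullet> p" "t \<notin> ?g ` E" for E p t
      using that B.face_bot[OF convex_std_poly closed_std_poly] by blast
    show "a \<bullet> x = c - b \<bullet> y" if "(x, y) extreme_point_of R" for x y using that by (rule level)
    show "(x, y) extreme_point_of R"
      if "x extreme_point_of ?P" "y extreme_point_of ?Q" "a \<bullet> x = c - b \<bullet> y" for x y
      by (rule extreme_point_fiber_product[of "{x}" "{y}"]) (use that in \<open>auto simp: face_of_singleton\<close>)
    show "(x, y) extreme_point_of R"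
      if E: "?FA E" "nonconst ?f E" "x \<in> E" and y: "y extreme_point_of ?Q" "a \<bullet> x = c - b \<bullet> y" for E x y
    proof (rule extreme_point_fiber_product[of E "{y}"])
      show "x' = x \<and> y' = y" if "x' \<in> E" "y' \<in> {y}" "a \<bullet> x' = c - b \<bullet> y'" for x' y'
      proof
        show "x' = x" by (rule A.collinear_inj[of E]) (use E y that in auto)
      qed (use that in simp)
    qed (use E y in \<open>auto simp: face_of_singleton\<close>)
    show "(x, y) extreme_point_of R"
      if E: "?FB E" "nonconst ?g E" "y \<in> E" and x: "x extreme_point_of ?P" "a \<bullet> x = c - b \<bullet> y" for E x y
    proof (rule extreme_point_fiber_product[of "{x}" E])
      show "x' = x \<and> y' = y" if "x' \<in> {x}" "y' \<in> E" "a \<bullet> x' = c - b \<bullet> y'" for x' y'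
      proof
        show "y' = y" by (rule B.collinear_inj[of E]) (use E x that in auto)
      qed (use that in simp)
    qed (use E x in \<open>auto simp: face_of_singleton\<close>)
    show "x extreme_point_of ?P \<or> y extreme_point_of ?Q" if "(x, y) extreme_point_of R" for x y
      using slice(3)[OF that] .
    show "\<exists>E w. ?FA E \<and> nonconst ?f E \<and> x \<in> E \<and> w \<in> E \<and> w extreme_point_of ?P"
      if "(x, y) extreme_point_of R" "\<not> x extreme_point_of ?P" for x y
      by (rule slice_vertex_edge[OF slice(1)[OF that(1)] that(2)]) blast
    show "\<exists>G w. ?FB G \<and> nonconst ?g G \<and> y \<in> G \<and> w \<in> G \<and> w extreme_point_of ?Q"
      if "(x, y) extreme_point_of R" "\<not> y extreme_point_of ?Q" for x y
      unfolding nonconst_g by (rule slice_vertex_edge[OF slice(2)[OF that(1)] that(2)]) blast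
    show "near R 0 (x, y) (x, y)" for x y by (rule near_refl)
    show "near R (m + n) (x, y) (x'', y'')" if "near R m (x, y) (x', y')" "near R n (x', y') (x'', y'')"
      for x y x' y' m x'' y'' n using that by (rule near_trans)
    show "near R n (x, y) (x', y')" if "near R m (x, y) (x', y')" "m \<le> n" for x y x' y' m n
      using that by (rule near_mono)
    show "near R n (x', y') (x, y)" if "near R n (x, y) (x', y')" for x y x' y' n using that by (rule near_sym)
    show "near R 1 (x, y) (x', y')"
      if "(x, y) extreme_point_of R" "(x', y') extreme_point_of R" "?FA E" "x \<in> E" "x' \<in> E" "?FB G"
        "y \<in> G" "y' \<in> G" "nonconst ?f E \<or> nonconst ?g G" for x y x' y' E G
      using near_tandem[of E G] that by simp
    show "near R DA (x, y) (x', y)"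
      if y: "y extreme_point_of ?Q" and W: "(x, y) extreme_point_of R" "(x', y) extreme_point_of R" for y x x'
    proof (rule near_map[where \<phi> = "\<lambda>x. (x, y)"])
      have "x extreme_point_of {z \<in> ?P. a \<bullet> z = c - b \<bullet> y}" "x' extreme_point_of {z \<in> ?P. a \<bullet> z = c - b \<bullet> y}"
        using slice(1)[OF W(1)] slice(1)[OF W(2)] level[OF W(1)] level[OF W(2)] by simp_all
      then show "near {z \<in> ?P. a \<bullet> z = c - b \<bullet> y} DA x x'"
        unfolding std_poly_stack_below by (rule mat_diam_near[OF DA])
      show "vertex_adj R (v, y) (w, y)" if "vertex_adj {z \<in> ?P. a \<bullet> z = c - b \<bullet> y} v w" for v w
        by (rule vertex_adj_fst[OF y that face_of_refl[OF convex_std_poly]])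
    qed
    show "near R DB (x, y) (x, y')"
      if x: "x extreme_point_of ?P" and W: "(x, y) extreme_point_of R" "(x, y') extreme_point_of R" for x y y'
    proof (rule near_map[where \<phi> = "\<lambda>y. (x, y)"])
      have "y extreme_point_of {z \<in> ?Q. b \<bullet> z = c - a \<bullet> x}" "y' extreme_point_of {z \<in> ?Q. b \<bullet> z = c - a \<bullet> x}"
        using slice(2)[OF W(1)] slice(2)[OF W(2)] level[OF W(1)] level[OF W(2)] by simp_all
      then have "near {z \<in> ?Q. b \<bullet> z = c - a \<bullet> x} DB y y'"
        unfolding std_poly_stack_below by (rule mat_diam_near[OF DB])
      moreover have "{z \<in> ?Q. b \<bullet> z = c - a \<bullet> x} = {z \<in> ?Q. c - b \<bullet> z = a \<bullet> x}" by auto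
      ultimately show "near {z \<in> ?Q. c - b \<bullet> z = a \<bullet> x} DB y y'" by simp
      show "vertex_adj R (x, v) (x, w)" if "vertex_adj {z \<in> ?Q. c - b \<bullet> z = a \<bullet> x} v w" for v w
        by (rule vertex_adj_snd[OF x that face_of_refl[OF convex_std_poly]])
    qed
    show "\<exists>n\<le>dA. \<exists>u. chain (\<lambda>x. x extreme_point_of ?P) ?FA u n \<and> u 0 = v \<and> u n = w"
      if "v extreme_point_of ?P" "w extreme_point_of ?P" for v w
      by (rule near_chain[OF mat_diam_near[OF dA that] that])
    show "\<exists>n\<le>dB. \<exists>u. chain (\<lambda>x. x extreme_point_of ?Q) ?FB u n \<and> u 0 = v \<and> u n = w"
      if "v extreme_point_of ?Q" "w extreme_point_of ?Q" for v w
      by (rule near_chain[OF mat_diam_near[OF dB that] that])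
    show "DA \<le> 1" if "dA = 0"
      using mat_diam_stack_below_le_1[of A a] dA DA that by (simp add: zero_enat_def one_enat_def)
    show "DB \<le> 1" if "dB = 0"
      using mat_diam_stack_below_le_1[of B b] dB DB that by (simp add: zero_enat_def one_enat_def)
  qed
  obtain x y x' y' where "v = (x, y)" "w = (x', y')" by (metis surj_pair)
  then show ?thesis using conn_bound ext by simp
qed

theorem theorem1:
  fixes A :: "real^'n1^'m1" and a :: "real^'n1"
    and b :: "real^'n2" and B :: "real^'n2^'m2"
    and cA :: "real^'m1" and cB :: "real^'m2" and c :: real
  assumes "a \<noteq> 0" and "b \<noteq> 0"
  defines "R \<equiv> {(x, y). A *v x = cA \<and> a \<bullet> x + b \<bullet> y = c \<and> B *v y = cB
                     \<and> (\<forall>i. 0 \<le> x $ i) \<and> (\<forall>j. 0 \<le> y $ j)}"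
  shows "poly_diam R \<le> mat_diam A * (mat_diam (stack_below A a) + 1)
                      + mat_diam B * (mat_diam (stack_above b B) + 1)
                      + min (mat_diam (stack_below A a) + mat_diam B + 1)
                            (mat_diam A + mat_diam (stack_above b B) + 1)"
proof (cases "mat_diam A * (mat_diam (stack_below A a) + 1) = \<infinity> \<or> mat_diam B * (mat_diam (stack_above b B) + 1) = \<infinity>")
  case True
  then show ?thesis by auto
next
  case False
  \<comment> \<open>\<open>D + 1\<close> is nonzero, so a finite product makes \<open>d\<close>
    finite; \<open>D\<close> is finite as well unless \<open>d = 0\<close>, where
    \<open>D \<le> 1\<close> takes over.\<close>
  have fin: "\<exists>n n'. d = enat n \<and> D = enat n'" if "d * (D + 1) \<noteq> \<infinity>" "d = 0 \<Longrightarrow> D \<le> 1" for d D :: enat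
    using that unfolding imult_is_infinity by (cases d; cases D) (auto simp: zero_enat_def one_enat_def)
  obtain dA DA where A: "mat_diam A = enat dA" "mat_diam (stack_below A a) = enat DA"
    using fin[OF _ mat_diam_stack_below_le_1[of A a]] False by blast
  obtain dB DB where B: "mat_diam B = enat dB" "mat_diam (stack_below B b) = enat DB"
    using fin[OF _ mat_diam_stack_below_le_1[of B b]] False unfolding stack_above_eq by blast
  have R: "R = {(x, y). x \<in> std_poly A cA \<and> y \<in> std_poly B cB \<and> a \<bullet> x = c - b \<bullet> y}"
    unfolding R_def std_poly_def by (auto simp: algebra_simps)
  have "poly_diam R \<le> enat (dA * (DA + 1) + dB * (DB + 1) + 1)"
    unfolding poly_diam_def
  proof (intro SUP_least)
    fix vw assume "vw \<in> {(v, w). v extreme_point_of R \<and> w extreme_point_of R}"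
    then show "poly_dist R (fst vw) (snd vw) \<le> enat (dA * (DA + 1) + dB * (DB + 1) + 1)"
      unfolding poly_dist_le_iff by (intro near_two_sum[OF R A B]) auto
  qed
  \<comment> \<open>Both arguments of the minimum are at least 1.\<close>
  also have "\<dots> \<le> enat dA * (enat DA + 1) + enat dB * (enat DB + 1)
      + min (enat DA + enat dB + 1) (enat dA + enat DB + 1)"
    by (simp add: one_enat_def)
  finally show ?thesis unfolding stack_above_eq A B .
qed

end
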